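(* Let $\Phi=(A;\{E_i\}_{i=0}^d;A^*;\{E_i^*\}_{i=0}^d)$ be a tridiagonal system of diameter $d\geq 1$ on $V$ over $\mathbb{K}$, and let $\Delta,\Psi\in\mathrm{End}(V)$ be the linear transformations attached to $\Phi$ as defined in the context. Then $\Delta$ and $\Psi$ commute: $\Delta\Psi=\Psi\Delta$.
   Context: $\mathbb{K}$ is a field, $V$ is a $\mathbb{K}$-vector space of finite positive dimension, $\mathrm{End}(V)$ is the algebra of linear maps $V\to V$, and $I$ is the identity. A tridiagonal pair (TD pair) on $V$ is an ordered pair $A,A^*\in\mathrm{End}(V)$ ($A^*$ is just a name, not an adjoint) such that: (i) $A$ and $A^*$ are each diagonalizable over $\mathbb{K}$; (ii) there is an ordering $\{V_i\}_{i=0}^d$ of the eigenspaces of $A$ with $A^*V_i\subseteq V_{i-1}+V_i+V_{i+1}$ for $0\le i\le d$, where $V_{-1}=V_{d+1}=0$; (iii) there is an ordering $\{V_i^*\}_{i=0}^{\delta}$ of the eigenspaces of $A^*$ with $AV_i^*\subseteq V_{i-1}^*+V_i^*+V_{i+1}^*$ for $0\le i\le\delta$, where $V_{-1}^*=V_{\delta+1}^*=0$; (iv) there is no subspace $W$ of $V$ with $AW\subseteq W$, $A^*W\subseteq W$, $W\ne0$, $W\ne V$. It is known that $d=\delta$; this is the diameter, and it is assumed that $d\ge1$. Orderings satisfying (ii) (resp. (iii)) are called standard. The primitive idempotent of a diagonalizable map associated with one of its eigenspaces is the projection of $V$ onto that eigenspace that kills the other eigenspaces. A tridiagonal system (TD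 system) on $V$ is a sequence $\Phi=(A;\{E_i\}_{i=0}^d;A^*;\{E_i^*\}_{i=0}^d)$ where $A,A^*$ is a TD pair on $V$, $\{E_i\}_{i=0}^d$ is an ordering of the primitive idempotents of $A$ such that $\{E_iV\}_{i=0}^d$ is standard, and $\{E_i^*\}_{i=0}^d$ is an ordering of the primitive idempotents of $A^*$ such that $\{E_i^*V\}_{i=0}^d$ is standard. Let $\theta_i$ be the eigenvalue of $A$ on $E_iV$. For $0\le i\le d$ set $U_i=(E_0^*V+\cdots+E_i^*V)\cap(E_iV+\cdots+E_dV)$ and $U_i^{\Downarrow}=(E_0^*V+\cdots+E_i^*V)\cap(E_0V+\cdots+E_{d-i}V)$. It is known that $V=\bigoplus_{i=0}^dU_i=\bigoplus_{i=0}^dU_i^{\Downarrow}$ (first and second split decompositions). Let $F_i$ be the projection of $V$ onto $U_i$ along $\bigoplus_{j\ne i}U_j$, and $F_i^{\Downarrow}$ the projection of $V$ onto $U_i^{\Downarrow}$ along $\bigoplus_{j\ne i}U_j^{\Downarrow}$. Define $\Delta=\sum_{h=0}^dF_h^{\Downarrow}F_h$. For $0\le i\le d/2$ set $K_i=(E_0^*V+\cdots+E_i^*V)\cap(E_iV+E_{i+1}V+\cdots+E_{d-i}V)$. For $0\le i\le j\le d+1$ set $\tau_{ij}=(x-\theta_i)(x-\theta_{i+1})\cdots(x-\theta_{j-1})\in\mathbb{K}[x]$, with $\tau_{ii}=1$ and $\tau_{i,i-1}=0$. For $0\le i\le d+1$ set $\vartheta_i=\sum_{h=0}^{i-1}\frac{\theta_h-\theta_{d-h}}{\theta_0-\theta_d}$.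 It is known that $V=\bigoplus_{0\le i\le d/2}\bigoplus_{j=i}^{d-i}\tau_{ij}(A)K_i$. $\Psi$ is the unique element of $\mathrm{End}(V)$ such that $\Psi\tau_{ij}(A)v=(\vartheta_j-\vartheta_i)\tau_{i,j-1}(A)v$ for all $0\le i\le d/2$, $i\le j\le d-i$, $v\in K_i$. *)

theory Defs
  imports "HOL-Library.Set_Algebras" "HOL-Computational_Algebra.Polynomial"
begin

text \<open>
  The vector space V is the whole type \<open>'b\<close>, with scalar multiplication \<open>*s\<close> over the field \<open>'a\<close>;
  elements of End(V) are functions \<open>f\<close> with \<open>Vector_Spaces.linear scale scale f\<close>.
  Sums of subspaces are sums of sets in the sense of \<open>Set_Algebras\<close>; the empty sum is \<open>{0}\<close>.
  A family indexed by \<open>0, ..., d\<close> is a function on \<open>nat\<close> whose values above \<open>d\<close> are ignored.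
\<close>

text \<open>
  A copy of \<open>vector_space\<close>: definitions made in \<open>vector_space\<close> itself would also be instantiated,
  under their unqualified names, by its interpretation for real vector spaces.
\<close>
locale td_space = vector_space scale
  for scale :: "'a::field \<Rightarrow> 'b::ab_group_add \<Rightarrow> 'b" (infixr "*s" 75)
begin

definition eigenspace :: "('b \<Rightarrow> 'b) \<Rightarrow> 'a \<Rightarrow> 'b set" where
  "eigenspace A c = {v. A v = c *s v}"

definition eigenspaces :: "('b \<Rightarrow> 'b) \<Rightarrow> 'b set set" where
  "eigenspaces A = {eigenspace A c | c. eigenspace A c \<noteq> {0}}"

definition diagonalizable :: "('b \<Rightarrow> 'b) \<Rightarrow> bool" where
  "diagonalizable A \<longleftrightarrow> span (\<Union>(eigenspaces A)) = UNIV"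

definition standard_ordering :: "('b \<Rightarrow> 'b) \<Rightarrow> ('b \<Rightarrow> 'b) \<Rightarrow> nat \<Rightarrow> (nat \<Rightarrow> 'b set) \<Rightarrow> bool" where
  "standard_ordering A B d W \<longleftrightarrow>
     bij_betw W {0..d} (eigenspaces A) \<and>
     (\<forall>i\<le>d. B ` W i \<subseteq> (if i = 0 then {0} else W (i - 1)) + W i
                        + (if i = d then {0} else W (i + 1)))"

definition tridiagonal_pair :: "('b \<Rightarrow> 'b) \<Rightarrow> ('b \<Rightarrow> 'b) \<Rightarrow> bool" where
  "tridiagonal_pair A As \<longleftrightarrow>
     Vector_Spaces.linear scale scale A \<and> Vector_Spaces.linear scale scale As \<and>
     diagonalizable A \<and> diagonalizable As \<and>
     (\<exists>d W. standard_ordering A As d W) \<and>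
     (\<exists>\<delta> Ws. standard_ordering As A \<delta> Ws) \<and>
     \<not> (\<exists>W. subspace W \<and> A ` W \<subseteq> W \<and> As ` W \<subseteq> W \<and> W \<noteq> {0} \<and> W \<noteq> UNIV)"

text \<open>The map \<open>f\<close> is the projection of V onto \<open>X\<close> along \<open>Y\<close>.\<close>
definition is_projection :: "'b set \<Rightarrow> 'b set \<Rightarrow> ('b \<Rightarrow> 'b) \<Rightarrow> bool" where
  "is_projection X Y f \<longleftrightarrow>
     Vector_Spaces.linear scale scale f \<and> f \<circ> f = f \<and> range f = X \<and> {v. f v = 0} = Y"

definition primitive_idempotents :: "('b \<Rightarrow> 'b) \<Rightarrow> ('b \<Rightarrow> 'b) set" where
  "primitive_idempotents A =
     {E. \<exists>W\<in>eigenspaces A. is_projection W (span (\<Union>(eigenspaces A - {W}))) E}"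

definition tridiagonal_system ::
    "nat \<Rightarrow> ('b \<Rightarrow> 'b) \<Rightarrow> (nat \<Rightarrow> 'b \<Rightarrow> 'b) \<Rightarrow> ('b \<Rightarrow> 'b) \<Rightarrow> (nat \<Rightarrow> 'b \<Rightarrow> 'b) \<Rightarrow> bool" where
  "tridiagonal_system d A E As Es \<longleftrightarrow>
     tridiagonal_pair A As \<and>
     bij_betw E {0..d} (primitive_idempotents A) \<and>
     standard_ordering A As d (\<lambda>i. range (E i)) \<and>
     bij_betw Es {0..d} (primitive_idempotents As) \<and>
     standard_ordering As A d (\<lambda>i. range (Es i))"

definition td_eigenvalue :: "('b \<Rightarrow> 'b) \<Rightarrow> (nat \<Rightarrow> 'b \<Rightarrow> 'b) \<Rightarrow> nat \<Rightarrow> 'a" where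
  "td_eigenvalue A E i = (THE c. range (E i) = eigenspace A c)"

definition split_U ::
    "nat \<Rightarrow> (nat \<Rightarrow> 'b \<Rightarrow> 'b) \<Rightarrow> (nat \<Rightarrow> 'b \<Rightarrow> 'b) \<Rightarrow> nat \<Rightarrow> 'b set" where
  "split_U d E Es i = (\<Sum>h=0..i. range (Es h)) \<inter> (\<Sum>h=i..d. range (E h))"

definition split_U_down ::
    "nat \<Rightarrow> (nat \<Rightarrow> 'b \<Rightarrow> 'b) \<Rightarrow> (nat \<Rightarrow> 'b \<Rightarrow> 'b) \<Rightarrow> nat \<Rightarrow> 'b set" where
  "split_U_down d E Es i = (\<Sum>h=0..i. range (Es h)) \<inter> (\<Sum>h=0..d-i. range (E h))"

definition summand_projection :: "nat \<Rightarrow> (nat \<Rightarrow> 'b set) \<Rightarrow> nat \<Rightarrow> 'b \<Rightarrow> 'b" where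
  "summand_projection d U i = (THE f. is_projection (U i) (\<Sum>j\<in>{0..d} - {i}. U j) f)"

definition Delta ::
    "nat \<Rightarrow> (nat \<Rightarrow> 'b \<Rightarrow> 'b) \<Rightarrow> (nat \<Rightarrow> 'b \<Rightarrow> 'b) \<Rightarrow> 'b \<Rightarrow> 'b" where
  "Delta d E Es v =
     (\<Sum>h=0..d. summand_projection d (split_U_down d E Es) h
                  (summand_projection d (split_U d E Es) h v))"

definition split_K ::
    "nat \<Rightarrow> (nat \<Rightarrow> 'b \<Rightarrow> 'b) \<Rightarrow> (nat \<Rightarrow> 'b \<Rightarrow> 'b) \<Rightarrow> nat \<Rightarrow> 'b set" where
  "split_K d E Es i = (\<Sum>h=0..i. range (Es h)) \<inter> (\<Sum>h=i..d-i. range (E h))"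

text \<open>The value \<open>p(A)\<close> of a polynomial at an endomorphism, applied to a vector.\<close>
definition poly_end :: "'a poly \<Rightarrow> ('b \<Rightarrow> 'b) \<Rightarrow> 'b \<Rightarrow> 'b" where
  "poly_end p A v = (\<Sum>k\<le>degree p. coeff p k *s (A ^^ k) v)"

text \<open>The second index is an integer so that \<open>tau A E i (i - 1) = 0\<close> makes sense for \<open>i = 0\<close> too.\<close>
definition tau :: "('b \<Rightarrow> 'b) \<Rightarrow> (nat \<Rightarrow> 'b \<Rightarrow> 'b) \<Rightarrow> nat \<Rightarrow> int \<Rightarrow> 'a poly" where
  "tau A E i j = (if j < int i then 0 else (\<Prod>h\<in>{i..<nat j}. [:- td_eigenvalue A E h, 1:]))"

definition vartheta :: "nat \<Rightarrow> ('b \<Rightarrow> 'b) \<Rightarrow> (nat \<Rightarrow> 'b \<Rightarrow> 'b) \<Rightarrow> nat \<Rightarrow> 'a" where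
  "vartheta d A E i =
     (\<Sum>h<i. (td_eigenvalue A E h - td_eigenvalue A E (d - h))
             / (td_eigenvalue A E 0 - td_eigenvalue A E d))"

definition Psi ::
    "nat \<Rightarrow> ('b \<Rightarrow> 'b) \<Rightarrow> (nat \<Rightarrow> 'b \<Rightarrow> 'b) \<Rightarrow> (nat \<Rightarrow> 'b \<Rightarrow> 'b) \<Rightarrow> 'b \<Rightarrow> 'b" where
  "Psi d A E Es = (THE P. Vector_Spaces.linear scale scale P \<and>
     (\<forall>i j v. 2 * i \<le> d \<and> i \<le> j \<and> j \<le> d - i \<and> v \<in> split_K d E Es i \<longrightarrow>
        P (poly_end (tau A E i (int j)) A v) =
          (vartheta d A E j - vartheta d A E i) *s poly_end (tau A E i (int j - 1)) A v))"

end

end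

theory Submission imports Defs begin

text \<open>
  Both maps are explicit on the vectors \<open>\<tau>\<^sub>i\<^sub>j(A) v\<close> with \<open>v\<close> in \<open>K\<^sub>i\<close>, which span \<open>V\<close>, and comparing the
  two formulas leaves an identity about the eigenvalues of \<open>A\<close> alone.

  Write \<open>N = d - 2i\<close>, \<open>t\<^sub>h = \<theta>\<^bsub>i+h\<^esub>\<close>, and for \<open>m \<le> N\<close> let \<open>\<tau>\<^sub>m = (x - t\<^sub>0)...(x - t\<^bsub>m-1\<^esub>)\<close> and
  \<open>\<eta>\<^sub>m = (x - t\<^sub>N)...(x - t\<^bsub>N-m+1\<^esub>)\<close>. A vector \<open>v\<close> of \<open>K\<^sub>i\<close> lies in \<open>U\<^sub>i\<close> and in its counterpart of the
  second split decomposition, so \<open>\<tau>\<^sub>m(A) v\<close> lies in the \<open>(i+m)\<close>-th summand of the first and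
  \<open>\<eta>\<^sub>m(A) v\<close> in the \<open>(i+m)\<close>-th summand of the second. Both polynomials are monic of degree \<open>m\<close>, and
  each application of \<open>A\<close> moves one step up the flag of sums of eigenspaces of the dual map; hence the two
  vectors agree modulo the previous step of that flag, which is exactly what makes
  \<open>\<Delta> \<tau>\<^sub>m(A) v = \<eta>\<^sub>m(A) v\<close> (lemma \<open>Delta_tau_op\<close>). By definition \<open>\<Psi> \<tau>\<^sub>m(A) v = c\<^sub>m \<tau>\<^bsub>m-1\<^esub>(A) v\<close>, where up
  to a constant factor \<open>c\<^sub>m\<close> is the sum of \<open>t\<^sub>h - t\<^bsub>N-h\<^esub>\<close> over \<open>h < m\<close>. So \<open>\<Delta>\<close> and \<open>\<Psi>\<close> commute as
  soon as \<open>\<Psi>\<close> lowers the reversed basis with the same constants,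
  \<open>\<Psi> \<eta>\<^sub>m(A) v = c\<^sub>m \<eta>\<^bsub>m-1\<^esub>(A) v\<close> (lemma \<open>Psi_eta_op\<close>).

  That statement fails for arbitrary scalars; it rests on \<open>\<theta>\<^bsub>k-1\<^esub> + \<theta>\<^bsub>k+1\<^esub> = b \<theta>\<^sub>k + g\<close>
  with \<open>b\<close>, \<open>g\<close> independent of \<open>k\<close>. Given this recurrence, the operator \<open>P\<close> on polynomials that sends
  \<open>\<tau>\<^sub>m\<close> to \<open>c\<^sub>m \<tau>\<^bsub>m-1\<^esub>\<close>, and multiplication by \<open>x\<close>, denoted \<open>X\<close>, satisfy
  \<open>X\<^sup>2P - b XPX + PX\<^sup>2 - g (XP + PX) - r P = C X + D\<close> with scalars \<open>r, C, D\<close>. The relation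
  determines \<open>P\<close> from its values at \<open>1\<close> and \<open>x\<close>, and all the constants are unchanged when the eigenvalues
  are reversed; so the operator built from the \<open>\<eta>\<^sub>m\<close> is the same \<open>P\<close>
  (lemma \<open>newton_coeff_shift\<close>, stated for the matrix that expresses the \<open>\<eta>\<^sub>m\<close> in the \<open>\<tau>\<^sub>k\<close>).

  The recurrence itself comes from the tridiagonal shape (lemma \<open>eigenvalue_recurrence\<close>). With \<open>B\<close> for the
  dual map, \<open>A\<^sup>2BA - ABA\<^sup>2\<close> connects only neighbouring eigenspaces of \<open>A\<close>, where it is a multiple of
  \<open>B\<close>; therefore it equals \<open>ZB - BZ\<close> for a polynomial \<open>Z\<close> in \<open>A\<close>. Applied to
  an eigenvector in the first eigenspace of \<open>B\<close>, the left side climbs at most three steps of the dual flag,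
  and this bounds the degree of \<open>Z\<close> by three. Comparing coefficients at neighbouring eigenvalues gives a symmetric
  quadratic relation between \<open>\<theta>\<^sub>k\<close> and \<open>\<theta>\<^bsub>k+1\<^esub>\<close>; two consecutive instances of it give the recurrence.

  The remaining work is the structure theory behind the two definitions: the split decompositions
  (\<open>low_high_disjoint\<close>, \<open>direct_U\<close>) follow from irreducibility, and the decomposition of \<open>V\<close> into the
  \<open>\<tau>\<^sub>i\<^sub>j(A) K\<^sub>i\<close> (\<open>ladder_span\<close>, \<open>ladder_indep\<close>) follows from the fact that
  \<open>\<tau>\<^bsub>i,d-i\<^esub>(A)\<close> maps \<open>U\<^sub>i\<close> bijectively onto \<open>U\<^bsub>d-i\<^esub>\<close>.
\<close>

section \<open>Sequences with a three-term recurrence\<close>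

text \<open>
  Eigenvalues are indexed by \<open>0, ..., d\<close>. Continuing them to all integers removes every boundary case
  from the identities below.
\<close>
lemma three_term_extension:
  fixes x y b g :: "'a::field"
  obtains t :: "int \<Rightarrow> 'a" where "t 0 = x" "t 1 = y"
    "\<And>k. t (k - 1) + t (k + 1) = b * t k + g"
proof -
  define F where "F p q = rec_nat (p, q) (\<lambda>_ r. (snd r, b * snd r + g - fst r))" for p q :: 'a
  have F0: "F p q 0 = (p, q)" and FS: "F p q (Suc n) = (snd (F p q n), b * snd (F p q n) + g - fst (F p q n))"
    for p q n by (simp_all add: F_def)
  have step: "fst (F p q n) + fst (F p q (Suc (Suc n))) = b * fst (F p q (Suc n)) + g" for p q n
    by (simp add: FS)
  define t where "t k = (if k \<ge> 0 then fst (F x y (nat k)) else fst (F y x (nat (1 - k))))" for k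
  have tF: "t k = fst (F x y (nat k))" if "k \<ge> 0" for k using that by (simp add: t_def)
  have tB: "t k = fst (F y x (nat (1 - k)))" if "k \<le> 1" for k
  proof -
    have "k < 0 \<or> k = 0 \<or> k = 1" using that by linarith
    then show ?thesis by (elim disjE) (auto simp: t_def F0 FS eval_nat_numeral)
  qed
  have "t (k - 1) + t (k + 1) = b * t k + g" for k
  proof (cases "k \<ge> 1")
    case True
    then have "nat k = Suc (nat (k - 1))" "nat (k + 1) = Suc (Suc (nat (k - 1)))" by linarith+
    then show ?thesis using step[of x y "nat (k - 1)"] True by (simp add: tF)
  next
    case False
    then have "nat (1 - k) = Suc (nat (1 - (k + 1)))" "nat (1 - (k - 1)) = Suc (Suc (nat (1 - (k + 1))))"
      by linarith+
    then show ?thesis using step[of y x "nat (1 - (k + 1))"] False by (simp add: tB add.commute)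
  qed
  moreover have "t 0 = x" "t 1 = y" by (simp_all add: t_def F0 FS)
  ultimately show thesis using that by blast
qed

lemma int_step_invariant:
  fixes f :: "int \<Rightarrow> 'c"
  assumes "\<And>k. f (k + 1) = f k"
  shows "f k = f 0"
proof (induction k rule: int_induct[where k = 0])
  case (step2 i)
  then show ?case using assms[of "i - 1"] by simp
qed (use assms in auto)

text \<open>
  The coefficient of \<open>(x - t\<^sub>0)...(x - t\<^bsub>k-1\<^esub>)\<close> in \<open>(x - u\<^sub>0)...(x - u\<^bsub>j-1\<^esub>)\<close>; see \<open>newton_expand\<close>.
\<close>
fun newton_coeff :: "(int \<Rightarrow> 'a::field) \<Rightarrow> (int \<Rightarrow> 'a) \<Rightarrow> nat \<Rightarrow> int \<Rightarrow> 'a" where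
  "newton_coeff t u 0 k = (if k = 0 then 1 else 0)"
| "newton_coeff t u (Suc j) k =
     newton_coeff t u j (k - 1) + (t k - u (int j)) * newton_coeff t u j k"

lemma newton_coeff_outside: "k < 0 \<or> int j < k \<Longrightarrow> newton_coeff t u j k = 0"
  by (induction j arbitrary: k) auto

text \<open>
  The increment of the left side from \<open>k\<close> to \<open>k + 1\<close> is
  \<open>(t\<^bsub>k+2\<^esub> - t\<^sub>k) (t\<^bsub>k+2\<^esub> + t\<^sub>k - b t\<^bsub>k+1\<^esub> - g) = 0\<close>.
\<close>
lemma quadratic_invariant:
  fixes t :: "int \<Rightarrow> 'a::field"
  assumes rec: "\<And>k. t (k - 1) + t (k + 1) = b * t k + g"
  shows "(t k)\<^sup>2 - b * t k * t (k + 1) + (t (k + 1))\<^sup>2 - g * (t k + t (k + 1)) =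
         (t 0)\<^sup>2 - b * t 0 * t 1 + (t 1)\<^sup>2 - g * (t 0 + t 1)"
proof -
  have "(t (k+1))\<^sup>2 - b * t (k+1) * t (k + 1 + 1) + (t (k + 1 + 1))\<^sup>2 - g * (t (k+1) + t (k + 1 + 1)) = 
     (t k)\<^sup>2 - b * t k * t (k + 1) + (t (k + 1))\<^sup>2 - g * (t k + t (k + 1))" for k
  proof -
    have "t k + t (k + 1 + 1) = b * t (k + 1) + g" using rec[of "k + 1"] by simp
    then show ?thesis by algebra
  qed
  from int_step_invariant[of "\<lambda>k. (t k)\<^sup>2 - b * t k * t (k + 1) + (t (k + 1))\<^sup>2 - g * (t k + t (k + 1))", OF this, of k]
  show ?thesis by simp
qed

text \<open>
  The diagonal coefficients in the relation between \<open>P\<close> and \<open>X\<close> (see \<open>newton_coeff_shift\<close>), with the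
  contribution of \<open>C X\<close> removed, are all equal: by the recurrence of \<open>t\<close> the increment is
  \<open>(t\<^bsub>k+1\<^esub> - t\<^sub>k) (c\<^bsub>k+2\<^esub> + c\<^sub>k - b c\<^bsub>k+1\<^esub> - C)\<close>, and by that of \<open>c\<close> it vanishes.
\<close>
lemma diagonal_invariant:
  fixes t c :: "int \<Rightarrow> 'a::field"
  assumes rec: "\<And>k. t (k - 1) + t (k + 1) = b * t k + g"
    and c: "\<And>k. c (k - 1) + c (k + 1) = b * c k + C"
  shows "c k * (t k - t (k + 1)) + c (k + 1) * (t k - t (k - 1)) - C * t k =
         c 0 * (t 0 - t 1) + c 1 * (t 0 - t (-1)) - C * t 0"
proof -
  have "c (k+1) * (t (k+1) - t (k + 1 + 1)) + c (k + 1 + 1) * (t (k+1) - t (k + 1 - 1)) - C * t (k+1) 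
     = c k * (t k - t (k + 1)) + c (k + 1) * (t k - t (k - 1)) - C * t k" for k
  proof -
    have "t k + t (k + 1 + 1) = b * t (k + 1) + g" "c k + c (k + 1 + 1) = b * c (k + 1) + C"
      using rec[of "k + 1"] c[of "k + 1"] by simp_all
    then show ?thesis using rec[of k] by (simp only: add_diff_cancel_right') algebra
  qed
  from int_step_invariant[of "\<lambda>k. c k * (t k - t (k + 1)) + c (k + 1) * (t k - t (k - 1)) - C * t k", OF this, of k]
  show ?thesis by simp
qed

text \<open>
  In terms of the operator \<open>P\<close> that lowers the basis of \<open>t\<close> with the constants \<open>c\<close>: the reversed basis is
  lowered by \<open>P\<close> with the same constants. The quadratic relation \<open>G\<close> between \<open>P\<close> and multiplication by
  \<open>x\<close> computes \<open>P(x\<^sup>2f)\<close> from \<open>P(xf)\<close> and \<open>P f\<close>, so an induction with two starting values suffices;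
  it closes because \<open>r\<close>, \<open>C\<close> and \<open>D\<close> are the same for the reversed sequence \<open>u\<close>.
\<close>
lemma newton_coeff_shift:
  fixes t c :: "int \<Rightarrow> 'a::field"
  assumes rec: "\<And>k. t (k - 1) + t (k + 1) = b * t k + g"
    and c0: "c 0 = 0" and c: "\<And>k. c (k + 1) = c k + t k - t (N - k)"
  shows "c (k + 1) * newton_coeff t (\<lambda>h. t (N - h)) (Suc j) (k + 1) =
         c (int j + 1) * newton_coeff t (\<lambda>h. t (N - h)) j k"
proof -
  define u where "u = (\<lambda>h. t (N - h))"
  define C where "C = c 0 + c 2 - b * c 1"
  define r where "r = (t 0)\<^sup>2 - b * t 0 * t 1 + (t 1)\<^sup>2 - g * (t 0 + t 1)"
  define D where "D = c 1 * (t 0 - t (-1)) - C * t 0"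
  have recu: "u (k - 1) + u (k + 1) = b * u k + g" for k
    using rec[of "N - k"] by (simp add: u_def algebra_simps)
  have recc: "c (k - 1) + c (k + 1) = b * c k + C" for k
  proof -
    have "c (k+1-1) + c (k+1+1) - b * c (k+1) = c (k-1) + c (k+1) - b * c k" for k
    proof -
      have "c k = c (k - 1) + t (k - 1) - u (k - 1)" "c (k+1) = c k + t k - u k" 
        "c (k+1+1) = c (k+1) + t (k+1) - u (k+1)"
        using c[of "k-1"] c[of k] c[of "k+1"] by (simp_all add: u_def)
      then show ?thesis using rec[of k] recu[of k] by (simp only: add_diff_cancel_right') algebra
    qed
    from int_step_invariant[of "\<lambda>k. c (k-1) + c (k+1) - b * c k", OF this, of k]
      int_step_invariant[of "\<lambda>k. c (k-1) + c (k+1) - b * c k", OF this, of 1]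
    have "c (k-1) + c (k+1) - b * c k = C" by (simp add: C_def)
    then show ?thesis by (simp add: diff_eq_eq add.commute)
  qed
  have c1: "c 1 = t 0 - u 0" and c2: "c 2 = t 0 + t 1 - u 0 - u 1"
    using c[of 0] c[of 1] c0 by (simp_all add: u_def)
  have quad: "(t k)\<^sup>2 - b * t k * t (k + 1) + (t (k + 1))\<^sup>2 - g * (t k + t (k + 1)) = r" for k
    unfolding r_def by (rule quadratic_invariant[OF rec])
  have ut: "u k = t (N - k - 1 + 1)" "u (k + 1) = t (N - k - 1)" for k
    by (simp_all add: u_def algebra_simps)
  have quadu: "(u k)\<^sup>2 - b * u k * u (k + 1) + (u (k + 1))\<^sup>2 - g * (u k + u (k + 1)) = r" for k
    using quad[of "N - k - 1"] unfolding ut by (simp add: algebra_simps)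
  have diag: "c k * (t k - t (k + 1)) + c (k + 1) * (t k - t (k - 1)) - C * t k = D" for k
    using diagonal_invariant[of t b g c C k, OF rec recc] by (simp add: D_def c0)
  have diagu: "c k * (u k - u (k + 1)) + c (k + 1) * (u k - u (k - 1)) - C * u k = D" for k
  proof -
    have "c 1 * (u 0 - u (-1)) - C * u 0 = D"
      using rec[of 0] recu[of 0] c1 c2 c0 unfolding D_def C_def by simp algebra
    then show ?thesis using diagonal_invariant[of u b g c C k, OF recu recc] by (simp add: c0)
  qed
  \<comment> \<open>A function \<open>f\<close> stands for the polynomial with coefficients \<open>f k\<close> in the basis of \<open>t\<close>; \<open>X\<close> is
     multiplication by the variable.\<close>
  define X where "X f k = f (k - 1) + t k * f k" for f :: "int \<Rightarrow> 'a" and k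
  define P where "P f k = c (k + 1) * f (k + 1)" for f :: "int \<Rightarrow> 'a" and k
  \<comment> \<open>The terms on the left that multiply \<open>f (k - 1)\<close>, \<open>f k\<close> and \<open>f (k + 1)\<close> are compared by means of
     \<open>recc\<close>, \<open>diag\<close> and \<open>quad\<close>, respectively.\<close>
  have G: "X (X (P f)) k - b * X (P (X f)) k + P (X (X f)) k - g * (X (P f) k + P (X f) k) - r * P f k 
      = C * X f k + D * f k" for f k
  proof -
    have a1: "c (k+1+1) = b * c (k+1) + C - c k" "t (k+1) = b * t k + g - t (k - 1)" "c (k+1) = b * c k + C - c (k-1)"
      using recc[of "k+1"] rec[of k] recc[of k] by (simp_all add: algebra_simps)
    show ?thesis unfolding X_def P_def
      using a1 quad[of k] diag[of k] by (simp only: add_diff_cancel_right' diff_add_cancel) algebra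
  qed
  define a where "a = newton_coeff t u"
  have aS: "a (Suc j) = (\<lambda>k. X (a j) k - u (int j) * a j k)" for j
    by (auto simp: a_def X_def algebra_simps)
  have "P (a (Suc j)) = (\<lambda>k. c (int j + 1) * a j k) \<and> P (a (Suc (Suc j))) = (\<lambda>k. c (int j + 2) * a (Suc j) k)"
  proof (induction j)
    case 0
    show ?case by (auto simp: fun_eq_iff P_def a_def c1 c2 c0 algebra_simps)
  next
    case (Suc j)
    define m where "m = int j"
    define f where "f = a (Suc j)"
    have a2: "a (Suc (Suc j)) = (\<lambda>k. X f k - u (m + 1) * f k)"
      by (simp add: f_def m_def aS[of "Suc j"] add.commute)
    have Pf: "P f = (\<lambda>k. c (m + 1) * a j k)" 
      using Suc by (simp add: f_def m_def)
    have PXf: "P (X f) = (\<lambda>k. c (m + 2) * f k + u (m + 1) * c (m + 1) * a j k)"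
    proof
      fix k
      have "P (X f) k = P (a (Suc (Suc j))) k + u (m + 1) * P f k"
        by (simp add: a2 P_def algebra_simps)
      then show "P (X f) k = c (m + 2) * f k + u (m + 1) * c (m + 1) * a j k"
        using Suc by (simp add: Pf f_def m_def)
    qed
    have Xa: "X (a j) = (\<lambda>k. f k + u m * a j k)"
      by (simp add: f_def m_def aS)
    have X_scale: "X (\<lambda>k. p * h k) = (\<lambda>k. p * X h k)"
      and X_add: "X (\<lambda>k. h k + h' k) = (\<lambda>k. X h k + X h' k)" for p h h'
      by (auto simp: X_def algebra_simps)
    have XPf: "X (P f) = (\<lambda>k. c (m + 1) * (f k + u m * a j k))"
      by (simp only: Pf X_scale Xa)
    have XXPf: "X (X (P f)) = (\<lambda>k. c (m + 1) * (X f k + u m * (f k + u m * a j k)))"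
      by (simp only: XPf X_scale X_add Xa)
    have XPXf: "X (P (X f)) = (\<lambda>k. c (m + 2) * X f k + u (m + 1) * c (m + 1) * (f k + u m * a j k))"
      by (simp only: PXf X_scale X_add Xa)
    have "P (a (Suc (Suc (Suc j)))) k = c (m + 3) * a (Suc (Suc j)) k" for k
    proof -
      have 1: "P (a (Suc (Suc (Suc j)))) k = P (X (X f)) k - (u (m+1) + u (m+2)) * P (X f) k
           + u (m+1) * u (m+2) * P f k"
        by (simp add: aS[of "Suc (Suc j)"] a2 P_def X_def m_def algebra_simps)
      have idx: "m + 1 + 1 = m + 2" "m + 1 - 1 = m" "m + 2 + 1 = m + 3" "m + 2 - 1 = m + 1"
        by simp_all
      \<comment> \<open>Relation \<open>G\<close> at \<open>f\<close> gives the goal up to three scalar factors, one for each of \<open>x\<close>, \<open>y\<close> and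
         \<open>z\<close>; they vanish by the recurrence of \<open>c\<close>, by \<open>diagu\<close> and by \<open>quadu\<close>.\<close>
      define c1 c2 c3 where "c1 = c (m + 1)" and "c2 = c (m + 2)" and "c3 = c (m + 3)"
      define u0 u1 u2 where "u0 = u m" and "u1 = u (m + 1)" and "u2 = u (m + 2)"
      define w x y z where "w = P (X (X f)) k" and "x = X f k" and "y = f k" and "z = a j k"
      have c3: "c1 + c3 = b * c2 + C" and u2: "u0 + u2 = b * u1 + g"
        using recc[of "m + 2", unfolded idx] recu[of "m + 1", unfolded idx]
        by (simp_all add: c1_def c2_def c3_def u0_def u1_def u2_def)
      have q: "u0\<^sup>2 - b * u0 * u1 + u1\<^sup>2 - g * (u0 + u1) = r"
        using quadu[of m] by (simp add: u0_def u1_def)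
      have e: "c1 * (u1 - u2) + c2 * (u1 - u0) - C * u1 = D"
        using diagu[of "m + 1"] unfolding idx by (simp add: c1_def c2_def u0_def u1_def u2_def)
      have w: "w = C * x + D * y + r * (c1 * z) + g * (c1 * (y + u0 * z) + (c2 * y + u1 * c1 * z))
          - c1 * (x + u0 * (y + u0 * z)) + b * (c2 * x + u1 * c1 * (y + u0 * z))"
        using G[of f k] fun_cong[OF XXPf, of k] fun_cong[OF XPXf, of k] fun_cong[OF XPf, of k]
          fun_cong[OF PXf, of k] fun_cong[OF Pf, of k]
        by (simp add: w_def x_def y_def z_def c1_def c2_def u0_def u1_def algebra_simps)
      have "D + g * (c1 + c2) - c1 * u0 + b * u1 * c1 - (u1 + u2) * c2 + c3 * u1 = 0"
        using c3 u2 e by algebra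
      moreover have "r + g * (u0 + u1) - u0\<^sup>2 + b * u1 * u0 - u1\<^sup>2 = 0"
        unfolding q[symmetric] by (simp add: algebra_simps)
      moreover have "C - c1 + b * c2 - c3 = 0" using c3 by algebra
      moreover have "w - (u1 + u2) * (c2 * y + u1 * c1 * z) + u1 * u2 * (c1 * z) - c3 * (x - u1 * y)
         = (C - c1 + b * c2 - c3) * x
           + (D + g * (c1 + c2) - c1 * u0 + b * u1 * c1 - (u1 + u2) * c2 + c3 * u1) * y
           + (r + g * (u0 + u1) - u0\<^sup>2 + b * u1 * u0 - u1\<^sup>2) * (c1 * z)"
        unfolding w by (simp add: algebra_simps power2_eq_square)
      ultimately have "w - (u1 + u2) * (c2 * y + u1 * c1 * z) + u1 * u2 * (c1 * z) = c3 * (x - u1 * y)"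
        by simp
      then show ?thesis
        unfolding 1 a2 PXf Pf by (simp add: w_def x_def y_def z_def c1_def c2_def c3_def u0_def u1_def u2_def)
    qed
    moreover have "c (int (Suc j) + 2) = c (m + 3)" "c (int (Suc j) + 1) = c (m + 2)" by (simp_all add: m_def add.commute)
    ultimately show ?case using Suc by (auto simp: m_def)
  qed
  then show ?thesis by (simp add: P_def a_def u_def fun_eq_iff)
qed

section \<open>Endomorphisms and direct sums\<close>

context td_space
begin

abbreviation endo :: "('b \<Rightarrow> 'b) \<Rightarrow> bool" where
  "endo f \<equiv> Vector_Spaces.linear scale scale f"

lemma endoI:
  assumes "\<And>x y. f (x + y) = f x + f y" "\<And>c x. f (c *s x) = c *s f x"
  shows "endo f"
  unfolding Vector_Spaces.linear_iff using assms vector_space_axioms by blast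

lemma
  assumes "endo f"
  shows endo_add: "f (x + y) = f x + f y"
    and endo_scale: "f (c *s x) = c *s f x"
    and endo_0: "f 0 = 0"
    and endo_diff: "f (x - y) = f x - f y"
    and endo_sum: "f (sum g I) = (\<Sum>i\<in>I. f (g i))"
proof -
  interpret f: Vector_Spaces.linear scale scale f by fact
  show "f (x + y) = f x + f y" "f (c *s x) = c *s f x" "f 0 = 0" "f (x - y) = f x - f y"
    "f (sum g I) = (\<Sum>i\<in>I. f (g i))"
    by (simp_all add: f.add f.scale f.diff f.sum)
qed

lemma endo_sum_fun: "(\<And>i. i \<in> I \<Longrightarrow> endo (f i)) \<Longrightarrow> endo (\<lambda>v. \<Sum>i\<in>I. f i v)"
  by (intro endoI) (simp_all add: endo_add endo_scale sum.distrib scale_sum_right)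

lemma endo_compose: "endo f \<Longrightarrow> endo g \<Longrightarrow> endo (f \<circ> g)"
  by (intro endoI) (simp_all add: endo_add endo_scale)

lemma endo_scaled: "endo f \<Longrightarrow> endo (\<lambda>v. c *s f v)"
  by (intro endoI) (simp_all add: endo_add endo_scale scale_right_distrib mult.commute)

lemma endo_id: "endo (\<lambda>v. v)" and endo_zero: "endo (\<lambda>v. 0)"
  by (intro endoI; simp)+

text \<open>
  A direct sum is the image of a family of injections \<open>g\<^sub>i\<close> on subspaces \<open>S\<^sub>i\<close>, so a linear map may be prescribed on
  each summand. This provides both the projections of a direct decomposition and the map \<open>\<Psi>\<close>.
\<close>
lemma direct_sum_extension:
  assumes sub: "\<And>i. i \<in> I \<Longrightarrow> subspace (S i)"
    and g: "\<And>i. i \<in> I \<Longrightarrow> endo (g i)" and h: "\<And>i. i \<in> I \<Longrightarrow> endo (h i)"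
    and fin: "finite I"
    and spans: "\<And>v. \<exists>k. (\<forall>i\<in>I. k i \<in> S i) \<and> v = (\<Sum>i\<in>I. g i (k i))"
    and indep: "\<And>k i. (\<forall>i\<in>I. k i \<in> S i) \<Longrightarrow> (\<Sum>i\<in>I. g i (k i)) = 0 \<Longrightarrow> i \<in> I \<Longrightarrow> k i = 0"
  obtains P where "endo P" "\<And>i x. i \<in> I \<Longrightarrow> x \<in> S i \<Longrightarrow> P (g i x) = h i x"
proof -
  obtain K where K: "\<And>v. (\<forall>i\<in>I. K v i \<in> S i) \<and> v = (\<Sum>i\<in>I. g i (K v i))"
    using spans by metis
  define P where "P v = (\<Sum>i\<in>I. h i (K v i))" for v
  have PI: "P v = (\<Sum>i\<in>I. h i (k i))" if k: "\<forall>i\<in>I. k i \<in> S i" and v: "v = (\<Sum>i\<in>I. g i (k i))" for k v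
  proof -
    have "(\<Sum>i\<in>I. g i (K v i - k i)) = 0"
      using K[of v] v g by (simp add: endo_diff sum_subtractf cong: sum.cong)
    moreover have "\<forall>i\<in>I. K v i - k i \<in> S i"
      using k K sub by (auto intro: subspace_diff)
    ultimately have "K v i - k i = 0" if "i \<in> I" for i using indep[of "\<lambda>i. K v i - k i"] that by blast
    then show ?thesis unfolding P_def by (intro sum.cong) auto
  qed
  have "P (v + w) = (\<Sum>i\<in>I. h i (K v i + K w i))" for v w
    using K[of v] K[of w] sub g
    by (intro PI) (auto intro: subspace_add simp: endo_add sum.distrib cong: sum.cong)
  moreover have "P (c *s v) = (\<Sum>i\<in>I. h i (c *s K v i))" for c v
    using K[of v] sub g
    by (intro PI) (auto intro: subspace_scale simp: endo_scale scale_sum_right[symmetric] cong: sum.cong)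
  ultimately have "endo P"
    using h by (intro endoI) (simp_all add: P_def endo_add endo_scale sum.distrib scale_sum_right cong: sum.cong)
  moreover have "P (g i x) = h i x" if "i \<in> I" "x \<in> S i" for i x
  proof -
    have "P (g i x) = (\<Sum>j\<in>I. h j (if j = i then x else 0))"
      using that g sub fin by (intro PI) (auto simp: if_distrib[of "g _"] endo_0 subspace_0 sum.delta cong: if_cong sum.cong)
    also have "\<dots> = (\<Sum>j\<in>I. if j = i then h j x else 0)"
      using h by (intro sum.cong) (auto simp: endo_0)
    finally show ?thesis using that fin by simp
  qed
  ultimately show thesis using that by blast
qed

definition direct_decomposition :: "nat \<Rightarrow> (nat \<Rightarrow> 'b set) \<Rightarrow> bool" where
  "direct_decomposition d U \<longleftrightarrow>
     (\<forall>i\<le>d. subspace (U i)) \<and>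
     (\<forall>v. \<exists>u. (\<forall>i\<le>d. u i \<in> U i) \<and> v = (\<Sum>i\<le>d. u i)) \<and>
     (\<forall>u. (\<forall>i\<le>d. u i \<in> U i) \<longrightarrow> (\<Sum>i\<le>d. u i) = 0 \<longrightarrow> (\<forall>i\<le>d. u i = 0))"

text \<open>
  Together with existence, this evaluates the definite description in \<open>summand_projection\<close>.
\<close>
lemma is_projection_unique:
  assumes "is_projection X Y f" "is_projection X Y f'"
  shows "f = f'"
proof
  fix v
  have f: "endo f" "f (f v) = f v" "range f = X" "{v. f v = 0} = Y"
    and f': "endo f'" "f' \<circ> f' = f'" "range f' = X" "{v. f' v = 0} = Y"
    using assms by (auto simp: is_projection_def dest: fun_cong)
  have "f (v - f v) = 0" using f by (simp add: endo_diff)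
  then have "f' (v - f v) = 0" using f f' by blast
  moreover obtain w where "f v = f' w" using f(3) f'(3) by blast
  then have "f' (f v) = f v" using f'(2) by (metis comp_apply)
  ultimately show "f v = f' v" using f'(1) by (simp add: endo_diff)
qed

lemma
  assumes dec: "direct_decomposition d U" and i: "i \<le> d"
  shows endo_summand_projection: "endo (summand_projection d U i)"
    and summand_projection_eq: "\<And>j u. j \<le> d \<Longrightarrow> u \<in> U j \<Longrightarrow>
          summand_projection d U i u = (if j = i then u else 0)"
proof -
  have sub: "subspace (U j)" if "j \<le> d" for j
    using dec that by (simp add: direct_decomposition_def)
  obtain P where P: "endo P" and PU: "\<And>j u. j \<in> {..d} \<Longrightarrow> u \<in> U j \<Longrightarrow> P u = (if j = i then u else 0)"
  proof (rule direct_sum_extension[of "{..d}" U "\<lambda>_ x. x" "\<lambda>j x. if j = i then x else 0"])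
    show "endo (\<lambda>x. if j = i then x else 0)" for j
      by (cases "j = i") (simp_all add: endo_id endo_zero)
  qed (use dec in \<open>auto simp: direct_decomposition_def endo_id Ball_def\<close>)
  have Psum: "P (\<Sum>j\<le>d. u j) = u i" if "\<forall>j\<le>d. u j \<in> U j" for u
  proof -
    have "P (\<Sum>j\<le>d. u j) = (\<Sum>j\<le>d. if j = i then u j else 0)"
      using that PU by (auto simp: endo_sum[OF P] intro: sum.cong)
    then show ?thesis using i by simp
  qed
  have ex: "\<exists>u. (\<forall>j\<le>d. u j \<in> U j) \<and> v = (\<Sum>j\<le>d. u j)" for v
    using dec by (simp add: direct_decomposition_def)
  have range: "range P = U i"
  proof
    show "range P \<subseteq> U i" using ex Psum i by (metis image_subsetI)
    show "U i \<subseteq> range P" using PU[of i] i by (metis atMost_iff rangeI subsetI)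
  qed
  have "{v. P v = 0} = (\<Sum>j\<in>{0..d} - {i}. U j)"
  proof (intro set_eqI iffI)
    fix v assume v: "v \<in> {v. P v = 0}"
    obtain u where u: "\<forall>j\<le>d. u j \<in> U j" "v = (\<Sum>j\<le>d. u j)" using ex by blast
    then have "u i = 0" using v Psum by simp
    then have "v = (\<Sum>j\<in>{0..d} - {i}. u j)"
      using u(2) i by (simp add: atLeast0AtMost sum.remove[of "{..d}" i u])
    then show "v \<in> (\<Sum>j\<in>{0..d} - {i}. U j)"
      using u(1) by (auto simp: set_sum_alt)
  next
    fix v assume "v \<in> (\<Sum>j\<in>{0..d} - {i}. U j)"
    then obtain u where "v = sum u ({0..d} - {i})" "\<forall>j\<in>{0..d} - {i}. u j \<in> U j"
      by (auto simp: set_sum_alt)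
    moreover from this have "P (u j) = 0" if "j \<in> {0..d} - {i}" for j
      using PU[of j "u j"] that by auto
    ultimately show "v \<in> {v. P v = 0}"
      by (simp add: endo_sum[OF P])
  qed
  moreover have "P \<circ> P = P"
    using range PU[of i] i by (auto simp: fun_eq_iff)
  ultimately have proj: "is_projection (U i) (\<Sum>j\<in>{0..d} - {i}. U j) P"
    using P range by (simp add: is_projection_def)
  have "summand_projection d U i = P"
    unfolding summand_projection_def using proj is_projection_unique by blast
  with P PU show "endo (summand_projection d U i)"
    "\<And>j u. j \<le> d \<Longrightarrow> u \<in> U j \<Longrightarrow> summand_projection d U i u = (if j = i then u else 0)"
    by auto
qed

text \<open>
  Evaluation at \<open>A\<close> of the Newton basis polynomial \<open>(x - t\<^sub>0)...(x - t\<^bsub>m-1\<^esub>)\<close>. The recursion appends the last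
  factor, which is the form in which these products act on flags and on split decompositions.
\<close>
fun newton :: "('b \<Rightarrow> 'b) \<Rightarrow> (nat \<Rightarrow> 'a) \<Rightarrow> nat \<Rightarrow> 'b \<Rightarrow> 'b" where
  "newton A t 0 v = v"
| "newton A t (Suc m) v = A (newton A t m v) - t m *s newton A t m v"

lemma endo_newton: "endo A \<Longrightarrow> endo (newton A t m)"
proof (induction m)
  case (Suc m)
  then show ?case
    by (intro endoI)
      (simp_all add: endo_add[of A] endo_scale[of A] endo_add[of "newton A t m"] endo_scale[of "newton A t m"] algebra_simps)
next
  case 0
  show ?case by (intro endoI) simp_all
qed

lemma newton_add: "newton A t (m + n) v = newton A (\<lambda>h. t (m + h)) n (newton A t m v)"
  by (induction n) simp_all

lemma newton_eigenvector:
  assumes "endo A" "A v = c *s v"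
  shows "newton A t m v = (\<Prod>h<m. c - t h) *s v"
  using assms by (induction m) (simp_all add: endo_scale algebra_simps)

lemma poly_end_eq:
  assumes "degree p \<le> n"
  shows "poly_end p A v = (\<Sum>k\<le>n. coeff p k *s (A ^^ k) v)"
  unfolding poly_end_def using assms
  by (intro sum.mono_neutral_left) (auto simp: coeff_eq_0)

text \<open>
  The coefficients of the product are those of \<open>x p\<close> minus those of \<open>c p\<close>; the shift by \<open>x\<close> becomes an
  application of \<open>A\<close>.
\<close>
lemma poly_end_mult_linear:
  assumes A: "endo A"
  shows "poly_end ([:- c, 1:] * p) A v = A (poly_end p A v) - c *s poly_end p A v"
proof -
  let ?n = "Suc (degree p)"
  have deg: "degree ([:- c, 1:] * p) \<le> ?n"
    using degree_mult_le[of "[:- c, 1:]" p] by simp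
  have "poly_end ([:- c, 1:] * p) A v = (\<Sum>k\<le>?n. coeff (pCons 0 p - smult c p) k *s (A ^^ k) v)"
    by (subst poly_end_eq[OF deg]) simp
  also have "\<dots> = (\<Sum>k\<le>?n. coeff (pCons 0 p) k *s (A ^^ k) v) - (\<Sum>k\<le>?n. coeff (smult c p) k *s (A ^^ k) v)"
    by (simp add: scale_left_diff_distrib sum_subtractf)
  also have "(\<Sum>k\<le>?n. coeff (pCons 0 p) k *s (A ^^ k) v) = A (poly_end p A v)"
    unfolding poly_end_def by (subst sum.atMost_Suc_shift) (simp add: endo_sum[OF A] endo_scale[OF A])
  also have "(\<Sum>k\<le>?n. coeff (smult c p) k *s (A ^^ k) v) = c *s poly_end p A v"
    unfolding poly_end_eq[of p ?n, OF le_SucI[OF order_refl]]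
    by (simp add: scale_sum_right scale_right_distrib)
  finally show ?thesis .
qed

lemma poly_end_prod:
  assumes "endo A"
  shows "poly_end (\<Prod>h\<in>{i..<i + m}. [:- t h, 1:]) A v = newton A (\<lambda>h. t (i + h)) m v"
proof (induction m)
  case (Suc m)
  then show ?case using poly_end_mult_linear[OF assms] by (simp add: mult.commute)
qed (simp add: poly_end_def)

text \<open>
  Change of Newton basis: the recursion of \<open>newton_coeff\<close> is multiplication by \<open>x - u\<^sub>m\<close>, using
  \<open>x \<tau>\<^sub>k = \<tau>\<^bsub>k+1\<^esub> + t\<^sub>k \<tau>\<^sub>k\<close>.
\<close>
lemma newton_expand:
  assumes A: "endo A" and "\<And>h. h < m \<Longrightarrow> t h = ti (int h)" and "\<And>h. h < m \<Longrightarrow> u h = ui (int h)"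
  shows "newton A u m v = (\<Sum>k\<le>m. newton_coeff ti ui m (int k) *s newton A t k v)"
  using assms(2,3)
proof (induction m)
  case (Suc m)
  let ?a = "\<lambda>k. newton_coeff ti ui m (int k)"
  let ?T = "\<lambda>k. newton A t k v"
  have AT: "A (?T k) = ?T (Suc k) + ti (int k) *s ?T k" if "k \<le> m" for k
    using Suc.prems(1)[of k] that by simp
  have "newton A u (Suc m) v = A (\<Sum>k\<le>m. ?a k *s ?T k) - ui (int m) *s (\<Sum>k\<le>m. ?a k *s ?T k)"
    using Suc by simp
  also have "A (\<Sum>k\<le>m. ?a k *s ?T k) = (\<Sum>k\<le>m. ?a k *s ?T (Suc k)) + (\<Sum>k\<le>m. (ti (int k) * ?a k) *s ?T k)"
    unfolding endo_sum[OF A] endo_scale[OF A] sum.distrib[symmetric]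
  proof (intro sum.cong refl)
    fix k assume "k \<in> {..m}"
    then show "?a k *s A (?T k) = ?a k *s ?T (Suc k) + (ti (int k) * ?a k) *s ?T k"
      using AT[of k] by (simp del: newton.simps add: scale_right_distrib mult.commute)
  qed
  also have "(\<Sum>k\<le>m. ?a k *s ?T (Suc k)) = (\<Sum>k\<le>Suc m. newton_coeff ti ui m (int k - 1) *s ?T k)"
    by (subst sum.atMost_Suc_shift) (simp add: newton_coeff_outside del: newton.simps)
  also have "(\<Sum>k\<le>m. (ti (int k) * ?a k) *s ?T k) = (\<Sum>k\<le>Suc m. (ti (int k) * ?a k) *s ?T k)"
    by (simp add: newton_coeff_outside del: newton.simps)
  also have "(\<Sum>k\<le>m. ?a k *s ?T k) = (\<Sum>k\<le>Suc m. ?a k *s ?T k)"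
    by (simp add: newton_coeff_outside del: newton.simps)
  finally show ?case
    by (simp only: scale_sum_right sum.distrib[symmetric] sum_subtractf[symmetric] newton_coeff.simps
          scale_scale scale_left_distrib[symmetric] scale_left_diff_distrib[symmetric])
       (simp only: left_diff_distrib add_diff_eq)
qed simp

end

section \<open>Tridiagonal systems in terms of idempotents\<close>

text \<open>
  A diagonalizable map with its primitive idempotents. Working with the projections rather than with the
  eigenspaces turns membership in a sum of eigenspaces into the vanishing of components, so that intersections
  of such sums need no argument.
\<close>
locale spectral_family = td_space scale
  for scale :: "'a::field \<Rightarrow> 'b::ab_group_add \<Rightarrow> 'b" (infixr "*s" 75) +
  fixes d :: nat and A :: "'b \<Rightarrow> 'b" and E :: "nat \<Rightarrow> 'b \<Rightarrow> 'b" and \<theta> :: "nat \<Rightarrow> 'a"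
  assumes endo_A: "endo A"
    and endo_E: "i \<le> d \<Longrightarrow> endo (E i)"
    and sum_E: "(\<Sum>i\<le>d. E i v) = v"
    and E_E: "i \<le> d \<Longrightarrow> j \<le> d \<Longrightarrow> E i (E j v) = (if i = j then E j v else 0)"
    and A_E: "i \<le> d \<Longrightarrow> A (E i v) = \<theta> i *s E i v"
    and \<theta>_inj: "inj_on \<theta> {..d}"
    and E_nonzero: "i \<le> d \<Longrightarrow> \<exists>v. E i v \<noteq> 0"
begin

lemma zero_by_components: "(\<And>i. i \<le> d \<Longrightarrow> E i v = 0) \<Longrightarrow> v = 0"
  using sum_E[of v] by simp

lemma E_comp:
  assumes f: "endo f" and i: "i \<le> d"
  shows "E i (f v) = (\<Sum>j\<le>d. E i (f (E j v)))"
proof -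
  have "E i (f v) = E i (f (\<Sum>j\<le>d. E j v))" by (simp only: sum_E)
  then show ?thesis by (simp only: endo_sum[OF f] endo_sum[OF endo_E[OF i]])
qed

lemma E_A:
  assumes i: "i \<le> d"
  shows "E i (A v) = \<theta> i *s E i v"
proof -
  have "E i (A v) = (\<Sum>j\<le>d. if j = i then \<theta> i *s E i v else 0)"
    unfolding E_comp[OF endo_A i, of v]
    using i by (intro sum.cong) (auto simp: A_E endo_scale[OF endo_E] E_E)
  then show ?thesis using i by simp
qed

lemma E_newton: "i \<le> d \<Longrightarrow> E i (newton A t m v) = (\<Prod>h<m. \<theta> i - t h) *s E i v"
  by (induction m) (simp_all add: endo_diff[OF endo_E] endo_scale[OF endo_E] E_A algebra_simps)

lemma newton_eq_0_imp_component:
  assumes i: "i \<le> d" and "newton A t m v = 0" and "\<And>h. h < m \<Longrightarrow> t h \<noteq> \<theta> i"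
  shows "E i v = 0"
proof -
  have "(\<Prod>h<m. \<theta> i - t h) *s E i v = 0"
    using E_newton[OF i, of t m v] assms(2) endo_0[OF endo_E[OF i]] by simp
  moreover have "(\<Prod>h<m. \<theta> i - t h) \<noteq> 0" using assms(3) by fastforce
  ultimately show ?thesis by simp
qed

lemma range_E_sum_iff:
  assumes "I \<subseteq> {..d}"
  shows "v \<in> (\<Sum>h\<in>I. range (E h)) \<longleftrightarrow> (\<forall>h\<le>d. h \<notin> I \<longrightarrow> E h v = 0)"
proof
  have fin: "finite I" using assms finite_subset by blast
  assume "v \<in> (\<Sum>h\<in>I. range (E h))"
  then obtain s where s: "v = sum s I" "\<forall>h\<in>I. s h \<in> range (E h)"
    unfolding set_sum_alt[OF fin] by blast
  have "E h v = 0" if "h \<le> d" "h \<notin> I" for h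
  proof -
    have "E h (s j) = 0" if "j \<in> I" for j
    proof -
      have "s j \<in> range (E j)" using s(2) that by simp
      then obtain w where "s j = E j w" by (rule rangeE)
      moreover have "j \<noteq> h" "j \<le> d" using \<open>h \<notin> I\<close> that assms by auto
      ultimately show ?thesis using \<open>h \<le> d\<close> by (simp add: E_E)
    qed
    then show ?thesis by (simp add: s(1) endo_sum[OF endo_E[OF \<open>h \<le> d\<close>]])
  qed
  then show "\<forall>h\<le>d. h \<notin> I \<longrightarrow> E h v = 0" by blast
next
  have fin: "finite I" using assms finite_subset by blast
  assume "\<forall>h\<le>d. h \<notin> I \<longrightarrow> E h v = 0"
  then have "(\<Sum>h\<le>d. E h v) = (\<Sum>h\<in>I. E h v)"
    using assms by (intro sum.mono_neutral_right) auto
  then show "v \<in> (\<Sum>h\<in>I. range (E h))"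
    unfolding set_sum_alt[OF fin] by (intro CollectI exI[of _ "\<lambda>h. E h v"]) (simp add: sum_E)
qed

lemma reverse: "spectral_family scale d A (\<lambda>i. E (d - i)) (\<lambda>i. \<theta> (d - i))"
proof (intro spectral_family.intro spectral_family_axioms.intro td_space_axioms)
  show "(\<Sum>i\<le>d. E (d - i) v) = v" for v
    using sum_E[of v] sum.nat_diff_reindex[of "\<lambda>i. E i v" "Suc d"] by (simp add: lessThan_Suc_atMost)
  show "inj_on (\<lambda>i. \<theta> (d - i)) {..d}"
  proof (rule inj_onI)
    fix x y assume xy: "x \<in> {..d}" "y \<in> {..d}" "\<theta> (d - x) = \<theta> (d - y)"
    then have "d - x = d - y" using inj_onD[OF \<theta>_inj, of "d - x" "d - y"] by simp
    then show "x = y" using xy by auto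
  qed
qed (auto simp: endo_A endo_E E_E A_E E_nonzero)

text \<open>
  Newton interpolation at the distinct points \<open>\<theta>\<^sub>i\<close>: the coefficient \<open>a\<^sub>n\<close> is determined by the value at
  \<open>\<theta>\<^sub>n\<close>, since its factor does not vanish there while all later terms do.
\<close>
lemma newton_interpolation:
  "\<exists>a. \<forall>i\<le>d. (\<Sum>k\<le>d. a k * (\<Prod>h<k. \<theta> i - \<theta> h)) = z i"
proof -
  have "\<exists>a. \<forall>i\<le>n. (\<Sum>k\<le>n. a k * (\<Prod>h<k. \<theta> i - \<theta> h)) = z i" if "n \<le> d" for n
    using that
  proof (induction n)
    case 0
    show ?case by (intro exI[of _ "\<lambda>_. z 0"]) simp
  next
    case (Suc n)
    then obtain a where a: "\<forall>i\<le>n. (\<Sum>k\<le>n. a k * (\<Prod>h<k. \<theta> i - \<theta> h)) = z i" by auto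
    define p where "p = (\<Prod>h<Suc n. \<theta> (Suc n) - \<theta> h)"
    have "\<theta> (Suc n) \<noteq> \<theta> h" if "h < Suc n" for h
      using inj_onD[OF \<theta>_inj, of "Suc n" h] Suc.prems that by auto
    then have "p \<noteq> 0" unfolding p_def by simp
    define b where "b = a(Suc n := (z (Suc n) - (\<Sum>k\<le>n. a k * (\<Prod>h<k. \<theta> (Suc n) - \<theta> h))) / p)"
    have eq: "(\<Sum>k\<le>n. b k * (\<Prod>h<k. \<theta> i - \<theta> h)) = (\<Sum>k\<le>n. a k * (\<Prod>h<k. \<theta> i - \<theta> h))" for i
      by (intro sum.cong) (auto simp: b_def)
    have "(\<Sum>k\<le>Suc n. b k * (\<Prod>h<k. \<theta> i - \<theta> h)) = z i" if "i \<le> Suc n" for i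
    proof (cases "i = Suc n")
      case True
      then show ?thesis using \<open>p \<noteq> 0\<close> unfolding sum.atMost_Suc eq by (simp add: b_def p_def)
    next
      case False
      then have "(\<Prod>h<Suc n. \<theta> i - \<theta> h) = 0" using that by (intro prod_zero) auto
      then show ?thesis using a False that unfolding sum.atMost_Suc eq by simp
    qed
    then show ?case by blast
  qed
  then show ?thesis by blast
qed

end

locale td_system = finite_dimensional_vector_space scale Basis + spectral_family scale d A E \<theta> +
    dual: spectral_family scale d As Es \<theta>s
  for scale :: "'a::field \<Rightarrow> 'b::ab_group_add \<Rightarrow> 'b" (infixr "*s" 75)
    and Basis d A E \<theta> As Es \<theta>s +
  assumes E_As_E: "i \<le> d \<Longrightarrow> j \<le> d \<Longrightarrow> Suc i < j \<or> Suc j < i \<Longrightarrow> E i (As (E j v)) = 0"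
    and Es_A_Es: "i \<le> d \<Longrightarrow> j \<le> d \<Longrightarrow> Suc i < j \<or> Suc j < i \<Longrightarrow> Es i (A (Es j v)) = 0"
    and irreducible: "subspace W \<Longrightarrow> A ` W \<subseteq> W \<Longrightarrow> As ` W \<subseteq> W \<Longrightarrow> W = {0} \<or> W = UNIV"
begin

text \<open>
  Reversing the order of the eigenspaces of \<open>A\<close> turns the first split decomposition into the second one.
  Everything proved about the first thereby holds for the second.
\<close>
lemma reverse_td_system: "td_system scale Basis d A (\<lambda>i. E (d - i)) (\<lambda>i. \<theta> (d - i)) As Es \<theta>s"
proof -
  interpret rev: spectral_family scale d A "\<lambda>i. E (d - i)" "\<lambda>i. \<theta> (d - i)" by (rule reverse)
  show ?thesis
  proof
    show "E (d - i) (As (E (d - j) v)) = 0" if "i \<le> d" "j \<le> d" "Suc i < j \<or> Suc j < i" for i j v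
      using that by (intro E_As_E) linarith+
  qed (use Es_A_Es irreducible in auto)
qed

text \<open>
  Both flags are indexed by the first step outside resp. inside, so that the zero space is \<open>low 0\<close> and the whole
  space is \<open>low (d + 1)\<close> and \<open>high 0\<close>.
\<close>
definition low :: "nat \<Rightarrow> 'b set" where
  "low i = {v. \<forall>h\<le>d. i \<le> h \<longrightarrow> Es h v = 0}"

definition high :: "nat \<Rightarrow> 'b set" where
  "high j = {v. \<forall>h\<le>d. h < j \<longrightarrow> E h v = 0}"

lemma subspace_low: "subspace (low i)"
  by (auto simp: low_def subspace_def endo_0[OF dual.endo_E] endo_add[OF dual.endo_E] endo_scale[OF dual.endo_E])

lemma subspace_high: "subspace (high j)"
  by (auto simp: high_def subspace_def endo_0[OF endo_E] endo_add[OF endo_E] endo_scale[OF endo_E])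

lemma low_mono: "i \<le> j \<Longrightarrow> low i \<subseteq> low j"
  by (auto simp: low_def)

lemma high_antimono: "i \<le> j \<Longrightarrow> high j \<subseteq> high i"
  by (auto simp: high_def)

lemma low_0: "v \<in> low 0 \<Longrightarrow> v = 0"
  by (rule dual.zero_by_components) (simp add: low_def)

lemma high_above: "d < j \<Longrightarrow> v \<in> high j \<Longrightarrow> v = 0"
  by (rule zero_by_components) (simp add: high_def)

lemma low_above: "d < i \<Longrightarrow> v \<in> low i" and high_0: "v \<in> high 0"
  by (auto simp: low_def high_def)

lemma A_low: "v \<in> low i \<Longrightarrow> A v \<in> low (Suc i)"
  unfolding low_def
proof (intro CollectI allI impI)
  fix h assume v: "v \<in> {v. \<forall>h\<le>d. i \<le> h \<longrightarrow> Es h v = 0}" and h: "h \<le> d" "Suc i \<le> h"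
  have "Es h (A (Es j v)) = 0" if "j \<le> d" for j
  proof (cases "i \<le> j")
    case True
    then show ?thesis using v that h by (simp add: endo_0[OF endo_A] endo_0[OF dual.endo_E])
  qed (use h that Es_A_Es in auto)
  then show "Es h (A v) = 0"
    unfolding dual.E_comp[OF endo_A h(1), of v] by simp
qed

lemma As_high: "v \<in> high j \<Longrightarrow> As v \<in> high (j - 1)"
  unfolding high_def
proof (intro CollectI allI impI)
  fix h assume v: "v \<in> {v. \<forall>h\<le>d. h < j \<longrightarrow> E h v = 0}" and h: "h \<le> d" "h < j - 1"
  have "E h (As (E i v)) = 0" if "i \<le> d" for i
  proof (cases "i < j")
    case True
    then show ?thesis using v that h by (simp add: endo_0[OF dual.endo_A] endo_0[OF endo_E])
  next
    case False
    then show ?thesis using h that by (intro E_As_E) linarith+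
  qed
  then show "E h (As v) = 0"
    unfolding E_comp[OF dual.endo_A h(1), of v] by simp
qed

lemma A_high: "v \<in> high j \<Longrightarrow> A v - \<theta> j *s v \<in> high (Suc j)"
  by (auto simp: high_def endo_diff[OF endo_E] endo_scale[OF endo_E] E_A less_Suc_eq)

lemma As_low: "v \<in> low (Suc i) \<Longrightarrow> As v - \<theta>s i *s v \<in> low i"
  by (auto simp: low_def endo_diff[OF dual.endo_E] endo_scale[OF dual.endo_E] dual.E_A)
     (metis Suc_leI diff_self le_neq_implies_less scale_zero_right)

section \<open>The split decompositions\<close>

text \<open>
  On \<open>low (i + p) \<inter> high (i + q)\<close> the map \<open>A\<close>, shifted by an eigenvalue, increases \<open>i\<close> by one, and the dual map,
  shifted likewise, decreases it by one. The span of these intersections over all \<open>i\<close> is therefore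
  invariant under both. The condition on \<open>p\<close> ensures that nothing is lost below \<open>i = 0\<close>.
\<close>
lemma ladder_span_trivial:
  fixes p q :: nat
  assumes "p \<le> 1"
  defines "M \<equiv> span (\<Union>i. low (i + p) \<inter> high (i + q))"
  shows "M = {0} \<or> M = UNIV"
proof (rule irreducible)
  let ?B = "\<Union>i. low (i + p) \<inter> high (i + q)"
  have inv: "f ` M \<subseteq> M" if f: "endo f" and B: "\<And>v. v \<in> ?B \<Longrightarrow> f v \<in> M" for f
  proof -
    have "subspace {v. f v \<in> M}"
      by (auto simp: subspace_def M_def endo_0[OF f] endo_add[OF f] endo_scale[OF f] span_zero span_add span_scale)
    then have "span ?B \<subseteq> {v. f v \<in> M}" using B by (intro span_minimal) auto
    then show ?thesis unfolding M_def by auto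
  qed
  show "subspace M" by (simp add: M_def)
  show "A ` M \<subseteq> M"
  proof (rule inv[OF endo_A])
    fix v assume "v \<in> ?B"
    then obtain i where v: "v \<in> low (i + p)" "v \<in> high (i + q)" by blast
    have "A v - \<theta> (i + q) *s v \<in> low (Suc i + p) \<inter> high (Suc i + q)"
      using A_low[OF v(1)] A_high[OF v(2)] v(1) low_mono[of "i + p" "Suc i + p"]
      by (auto intro: subspace_diff[OF subspace_low] subspace_scale[OF subspace_low])
    then have "A v - \<theta> (i + q) *s v \<in> M" unfolding M_def by (intro span_base) blast
    moreover have "v \<in> M" unfolding M_def using v by (intro span_base) blast
    ultimately have "(A v - \<theta> (i + q) *s v) + \<theta> (i + q) *s v \<in> M"
      unfolding M_def by (intro span_add span_scale)
    then show "A v \<in> M" by simp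
  qed
  show "As ` M \<subseteq> M"
  proof (rule inv[OF dual.endo_A])
    fix v assume "v \<in> ?B"
    then obtain i where v: "v \<in> low (i + p)" "v \<in> high (i + q)" by blast
    have vM: "v \<in> M" unfolding M_def using v by (intro span_base) blast
    show "As v \<in> M"
    proof (cases i)
      case 0
      show ?thesis
      proof (cases "p = 0")
        case True
        then have "v = 0" using v 0 low_0 by simp
        then show ?thesis by (simp add: endo_0[OF dual.endo_A] M_def span_zero)
      next
        case False
        then have "p = Suc 0" using \<open>p \<le> 1\<close> by simp
        then have "As v - \<theta>s 0 *s v = 0" using v 0 As_low[of v 0] by (intro low_0) simp
        then have "As v = \<theta>s 0 *s v" by simp
        then show ?thesis using vM by (simp add: M_def span_scale)
      qed
    next
      case (Suc j)
      then have v': "v \<in> low (Suc (j + p))" using v by simp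
      have "As v \<in> high (j + q)" using As_high[OF v(2)] Suc by simp
      moreover have "v \<in> high (j + q)" using v(2) Suc high_antimono[of "j + q" "i + q"] by auto
      ultimately have "As v - \<theta>s (j + p) *s v \<in> low (j + p) \<inter> high (j + q)"
        using As_low[OF v'] by (auto intro: subspace_diff[OF subspace_high] subspace_scale[OF subspace_high])
      then have "As v - \<theta>s (j + p) *s v \<in> M" unfolding M_def by (intro span_base) blast
      then have "(As v - \<theta>s (j + p) *s v) + \<theta>s (j + p) *s v \<in> M"
        using vM unfolding M_def by (intro span_add span_scale)
      then show ?thesis by simp
    qed
  qed
qed

text \<open>
  The intersections along the diagonal \<open>j - i\<close> all lie in \<open>high 1\<close>, because \<open>low 0\<close> is zero. Their span
  is therefore proper, and irreducibility makes it zero.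
\<close>
lemma low_high_disjoint:
  assumes "i \<le> j" "v \<in> low i" "v \<in> high j"
  shows "v = 0"
proof -
  let ?B = "\<Union>k. low (k + 0) \<inter> high (k + (j - i))"
  have "v \<in> span ?B" using assms by (intro span_base) (auto intro!: exI[of _ i])
  moreover have "span ?B \<subseteq> high 1"
  proof (intro span_minimal subspace_high UN_least)
    fix k show "low (k + 0) \<inter> high (k + (j - i)) \<subseteq> high 1"
    proof (cases k)
      case 0
      then show ?thesis using low_0 subspace_0[OF subspace_high] by auto
    next
      case (Suc l)
      then show ?thesis using high_antimono[of 1 "k + (j - i)"] by auto
    qed
  qed
  moreover have "\<exists>w. w \<notin> high 1"
  proof -
    obtain w where "E 0 w \<noteq> 0" using E_nonzero by blast
    then show ?thesis by (auto simp: high_def)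
  qed
  ultimately show ?thesis using ladder_span_trivial[of 0 "j - i"] by auto
qed

text \<open>The summands of the first split decomposition; see \<open>split_U_eq\<close>.\<close>
definition U :: "nat \<Rightarrow> 'b set" where
  "U i = low (Suc i) \<inter> high i"

lemma subspace_U: "subspace (U i)"
  unfolding U_def by (intro subspace_inter subspace_low subspace_high)

text \<open>
  Here the invariant span contains the last eigenspace of \<open>A\<close>, so irreducibility makes it the whole space.
\<close>
lemma U_sum_ex: "\<exists>u. (\<forall>i\<le>d. u i \<in> U i) \<and> v = (\<Sum>i\<le>d. u i)"
proof -
  let ?B = "\<Union>i. low (i + 1) \<inter> high (i + 0)"
  let ?S = "{v. \<exists>u. (\<forall>i\<le>d. u i \<in> U i) \<and> v = (\<Sum>i\<le>d. u i)}"
  obtain w where w: "E d w \<noteq> 0" using E_nonzero by blast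
  have "E d w \<in> low (d + 1) \<inter> high (d + 0)" by (auto simp: high_def E_E low_above)
  then have "E d w \<in> span ?B" by (intro span_base) blast
  then have "span ?B = UNIV" using ladder_span_trivial[of 1 0] w by auto
  moreover have "span ?B \<subseteq> ?S"
  proof (rule span_minimal)
    show "?B \<subseteq> ?S"
    proof
      fix v assume "v \<in> ?B"
      then obtain i where v: "v \<in> U i" by (auto simp: U_def)
      show "v \<in> ?S"
      proof (cases "i \<le> d")
        case True
        then show ?thesis using v subspace_0[OF subspace_U]
          by (intro CollectI exI[of _ "\<lambda>j. if j = i then v else 0"]) auto
      next
        case False
        then have "v = 0" using v high_above[of i v] by (simp add: U_def)
        then show ?thesis using subspace_0[OF subspace_U]
          by (intro CollectI exI[of _ "\<lambda>j. 0"]) auto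
      qed
    qed
    show "subspace ?S"
    proof (rule subspaceI)
      show "0 \<in> ?S" using subspace_0[OF subspace_U] by (intro CollectI exI[of _ "\<lambda>j. 0"]) auto
    next
      fix x y assume "x \<in> ?S" "y \<in> ?S"
      then obtain u u' where "\<forall>i\<le>d. u i \<in> U i" "x = (\<Sum>i\<le>d. u i)" "\<forall>i\<le>d. u' i \<in> U i" "y = (\<Sum>i\<le>d. u' i)"
        by blast
      then show "x + y \<in> ?S"
        by (intro CollectI exI[of _ "\<lambda>i. u i + u' i"]) (auto simp: sum.distrib intro: subspace_add[OF subspace_U])
    next
      fix c x assume "x \<in> ?S"
      then obtain u where "\<forall>i\<le>d. u i \<in> U i" "x = (\<Sum>i\<le>d. u i)" by blast
      then show "c *s x \<in> ?S"
        by (intro CollectI exI[of _ "\<lambda>i. c *s u i"]) (auto simp: scale_sum_right intro: subspace_scale[OF subspace_U])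
    qed
  qed
  ultimately show ?thesis by blast
qed

text \<open>
  A nonzero component with the largest index \<open>i \<ge> m\<close> would lie in \<open>low i\<close> as well as in \<open>high i\<close>. This says that the flag
  \<open>low\<close> is the partial sums of the decomposition; with \<open>m = 0\<close> it gives directness.
\<close>
lemma U_components_low:
  assumes u: "\<And>i. i \<le> d \<Longrightarrow> u i \<in> U i" and v: "(\<Sum>i\<le>d. u i) \<in> low m"
    and i: "m \<le> i" "i \<le> d"
  shows "u i = 0"
  using i
proof (induction "d - i" arbitrary: i rule: less_induct)
  case less
  have "u k \<in> low i" if "k \<le> d" "k \<noteq> i" for k
  proof (cases "k < i")
    case True
    then show ?thesis using u[OF that(1)] low_mono[of "Suc k" i] by (auto simp: U_def)
  next
    case False
    then have "u k = 0" using less that by (intro less.hyps) auto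
    then show ?thesis using subspace_0[OF subspace_low] by simp
  qed
  then have "(\<Sum>k\<in>{..d} - {i}. u k) \<in> low i" by (intro subspace_sum[OF subspace_low]) auto
  moreover have "(\<Sum>k\<le>d. u k) \<in> low i" using v less low_mono[of m i] by auto
  moreover have "(\<Sum>k\<le>d. u k) = u i + (\<Sum>k\<in>{..d} - {i}. u k)"
    using less by (simp add: sum.remove)
  ultimately have "u i \<in> low i" using subspace_diff[OF subspace_low] by fastforce
  moreover have "u i \<in> high i" using u less by (auto simp: U_def)
  ultimately show ?case using low_high_disjoint by blast
qed

lemma U_components_high:
  assumes u: "\<And>i. i \<le> d \<Longrightarrow> u i \<in> U i" and v: "(\<Sum>i\<le>d. u i) \<in> high m"
    and i: "i < m" "i \<le> d"
  shows "u i = 0"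
  using i
proof (induction i rule: less_induct)
  case (less i)
  have "u k \<in> high (Suc i)" if "k \<le> d" "k \<noteq> i" for k
  proof (cases "i < k")
    case True
    then show ?thesis using u[OF that(1)] high_antimono[of "Suc i" k] by (auto simp: U_def)
  next
    case False
    then have "u k = 0" using less that by (intro less.IH) auto
    then show ?thesis using subspace_0[OF subspace_high] by simp
  qed
  then have "(\<Sum>k\<in>{..d} - {i}. u k) \<in> high (Suc i)" by (intro subspace_sum[OF subspace_high]) auto
  moreover have "(\<Sum>k\<le>d. u k) \<in> high (Suc i)" using v less high_antimono[of "Suc i" m] by auto
  moreover have "(\<Sum>k\<le>d. u k) = u i + (\<Sum>k\<in>{..d} - {i}. u k)"
    using less by (simp add: sum.remove)
  ultimately have "u i \<in> high (Suc i)" using subspace_diff[OF subspace_high] by fastforce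
  moreover have "u i \<in> low (Suc i)" using u less by (auto simp: U_def)
  ultimately show ?case using low_high_disjoint by blast
qed

lemma direct_U: "direct_decomposition d U"
  unfolding direct_decomposition_def
  using subspace_U U_sum_ex U_components_low[of _ 0] subspace_0[OF subspace_low, of 0]
  by (metis le0)

lemma dim_image_of_trivial_kernel:
  assumes S: "subspace S" and f: "endo f" and ker: "\<And>v. v \<in> S \<Longrightarrow> f v = 0 \<Longrightarrow> v = 0"
  shows "dim (f ` S) = dim S"
proof -
  interpret pair: finite_dimensional_vector_space_pair_1 scale Basis scale ..
  have "inj_on f (span S)"
  proof (rule inj_onI)
    fix x y assume "x \<in> span S" "y \<in> span S" "f x = f y"
    then have "x - y \<in> S" "f (x - y) = 0"
      using S subspace_diff[OF S] endo_diff[OF f] by (auto simp: span_eq_iff[THEN iffD2])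
    then show "x = y" using ker by fastforce
  qed
  then show ?thesis by (rule pair.dim_image_eq[OF f])
qed

text \<open>
  \<open>U i\<close> is a complement of \<open>low i\<close> in \<open>low (i + 1)\<close>, and so is the \<open>i\<close>-th eigenspace of the dual map; the
  projection onto the latter identifies them.
\<close>
lemma dim_U_Es:
  assumes i: "i \<le> d"
  shows "dim (U i) = dim (range (Es i))"
proof -
  have Ei: "endo (Es i)" using dual.endo_E i .
  have "v = 0" if "v \<in> U i" "Es i v = 0" for v
  proof (rule low_high_disjoint[of i i])
    show "v \<in> low i" using that by (auto simp: U_def low_def le_less Suc_le_eq)
  qed (use that in \<open>auto simp: U_def\<close>)
  then have "dim (Es i ` U i) = dim (U i)" by (intro dim_image_of_trivial_kernel subspace_U Ei)
  moreover have "Es i ` U i = range (Es i)"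
  proof (intro equalityI subsetI)
    fix w assume "w \<in> range (Es i)"
    then have w: "Es i w = w" "w \<in> low (Suc i)" using i by (auto simp: dual.E_E low_def)
    obtain u where u: "\<forall>k\<le>d. u k \<in> U k" "w = (\<Sum>k\<le>d. u k)" using U_sum_ex by blast
    have "Es i (u k) = 0" if "k \<le> d" "k \<noteq> i" for k
    proof (cases "k < i")
      case True
      then show ?thesis using u(1) that i by (auto simp: U_def low_def)
    next
      case False
      then have "u k = 0" using u w that by (intro U_components_low[of u "Suc i"]) auto
      then show ?thesis using endo_0[OF Ei] by simp
    qed
    then have "(\<Sum>k\<le>d. Es i (u k)) = Es i (u i)" using i by (simp add: sum.remove[of "{..d}" i])
    then have "w = Es i (u i)" using w(1) u(2) by (metis endo_sum[OF Ei])
    then show "w \<in> Es i ` U i" using u(1) i by blast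
  qed auto
  ultimately show ?thesis by simp
qed

text \<open>The same with \<open>high\<close> in place of \<open>low\<close>.\<close>
lemma dim_U_E:
  assumes i: "i \<le> d"
  shows "dim (U i) = dim (range (E i))"
proof -
  have Ei: "endo (E i)" using endo_E i .
  have "v = 0" if "v \<in> U i" "E i v = 0" for v
  proof (rule low_high_disjoint[of "Suc i" "Suc i"])
    show "v \<in> high (Suc i)" using that by (auto simp: U_def high_def less_Suc_eq)
  qed (use that in \<open>auto simp: U_def\<close>)
  then have "dim (E i ` U i) = dim (U i)" by (intro dim_image_of_trivial_kernel subspace_U Ei)
  moreover have "E i ` U i = range (E i)"
  proof (intro equalityI subsetI)
    fix w assume "w \<in> range (E i)"
    then have w: "E i w = w" "w \<in> high i" using i by (auto simp: E_E high_def)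
    obtain u where u: "\<forall>k\<le>d. u k \<in> U k" "w = (\<Sum>k\<le>d. u k)" using U_sum_ex by blast
    have "E i (u k) = 0" if "k \<le> d" "k \<noteq> i" for k
    proof (cases "i < k")
      case True
      then show ?thesis using u(1) that i by (auto simp: U_def high_def)
    next
      case False
      then have "u k = 0" using u w that by (intro U_components_high[of u i]) auto
      then show ?thesis using endo_0[OF Ei] by simp
    qed
    then have "(\<Sum>k\<le>d. E i (u k)) = E i (u i)" using i by (simp add: sum.remove[of "{..d}" i])
    then have "w = E i (u i)" using w(1) u(2) by (metis endo_sum[OF Ei])
    then show "w \<in> E i ` U i" using u(1) i by blast
  qed auto
  ultimately show ?thesis by simp
qed

section \<open>The decomposition into ladders\<close>

text \<open>The map \<open>\<tau>\<^bsub>i,i+m\<^esub>(A)\<close>; see \<open>poly_end_tau\<close>.\<close>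
definition tau_op :: "nat \<Rightarrow> nat \<Rightarrow> 'b \<Rightarrow> 'b" where
  "tau_op i m = newton A (\<lambda>h. \<theta> (i + h)) m"

lemma endo_tau_op: "endo (tau_op i m)"
  by (simp add: tau_op_def endo_newton endo_A)

lemma tau_op_0: "tau_op i 0 v = v" and tau_op_Suc: "tau_op i (Suc m) v = A (tau_op i m v) - \<theta> (i + m) *s tau_op i m v"
  by (simp_all add: tau_op_def)

lemma tau_op_tau_op: "i + m = j \<Longrightarrow> tau_op j n (tau_op i m v) = tau_op i (m + n) v"
  unfolding tau_op_def newton_add by (auto simp: add.assoc)

lemma tau_op_U: "v \<in> U i \<Longrightarrow> tau_op i m v \<in> U (i + m)"
proof (induction m)
  case (Suc m)
  then have w: "tau_op i m v \<in> low (Suc (i + m))" "tau_op i m v \<in> high (i + m)" by (auto simp: U_def)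
  then show ?case
    using A_low[OF w(1)] A_high[OF w(2)] w(1) low_mono[of "Suc (i + m)" "Suc (Suc (i + m))"]
    by (auto simp: U_def tau_op_Suc intro!: subspace_diff[OF subspace_low] subspace_scale[OF subspace_low])
qed (simp add: tau_op_0)

end

context td_system
begin

interpretation rev: td_system scale Basis d A "\<lambda>i. E (d - i)" "\<lambda>i. \<theta> (d - i)" As Es \<theta>s
  by (rule reverse_td_system)

definition U_down :: "nat \<Rightarrow> 'b set" where
  "U_down = rev.U"

text \<open>
  An element of \<open>U i\<close> has no components before the \<open>i\<close>-th eigenspace of \<open>A\<close>, and one of \<open>U_down i\<close> none
  after the \<open>(d - i)\<close>-th. Hence this is the space \<open>K\<^sub>i\<close>; see \<open>split_K_eq\<close>.
\<close>
definition K :: "nat \<Rightarrow> 'b set" where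
  "K i = U i \<inter> U_down i"

text \<open>The counterpart of \<open>tau_op\<close> for the reversed ordering of the eigenvalues.\<close>
definition eta_op :: "nat \<Rightarrow> nat \<Rightarrow> 'b \<Rightarrow> 'b" where
  "eta_op i m = newton A (\<lambda>h. \<theta> (d - (i + h))) m"

lemma rev_tau_op: "rev.tau_op = eta_op"
  by (simp add: rev.tau_op_def eta_op_def fun_eq_iff)

text \<open>
  In the first decomposition \<open>U (d - i)\<close> matches the \<open>(d - i)\<close>-th eigenspace of \<open>A\<close>. The second decomposition
  matches that eigenspace with its own \<open>i\<close>-th summand, hence with the \<open>i\<close>-th eigenspace of the dual map,
  and so with \<open>U i\<close>.
\<close>
lemma dim_U_reverse:
  assumes "i \<le> d"
  shows "dim (U (d - i)) = dim (U i)"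
  using dim_U_E[of "d - i"] rev.dim_U_E[of i] rev.dim_U_Es[of i] dim_U_Es[of i] assms by simp

lemma eta_op_U_down: "v \<in> U_down i \<Longrightarrow> eta_op i m v \<in> U_down (i + m)"
  using rev.tau_op_U unfolding rev_tau_op U_down_def .

text \<open>
  A vector in the kernel has components only in the \<open>m\<close> eigenspaces of \<open>A\<close> from the \<open>i\<close>-th on, which come before the
  \<open>(d - i)\<close>-th one. Disjointness of the flags for the reversed system then makes it zero.
\<close>
lemma tau_op_inj:
  assumes v: "v \<in> U i" and "i + (i + m) \<le> d" and "tau_op i m v = 0"
  shows "v = 0"
proof (rule rev.low_high_disjoint[of "Suc i" "Suc i"])
  show "v \<in> low (Suc i)" using v by (simp add: U_def)
  show "v \<in> rev.high (Suc i)"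
    unfolding rev.high_def
  proof (intro CollectI allI impI)
    fix h assume h: "h \<le> d" "h < Suc i"
    show "E (d - h) v = 0"
    proof (rule newton_eq_0_imp_component[of _ "\<lambda>h. \<theta> (i + h)" m])
      fix l assume "l < m"
      then have "i + l < d - h" "i + l \<le> d" using h assms(2) by linarith+
      then show "\<theta> (i + l) \<noteq> \<theta> (d - h)" using inj_onD[OF \<theta>_inj, of "i + l" "d - h"] by auto
    qed (use assms(3) in \<open>auto simp: tau_op_def\<close>)
  qed
qed simp

lemma tau_op_surj:
  assumes i: "2 * i \<le> d" and w: "w \<in> U (d - i)"
  obtains v where "v \<in> U i" "tau_op i (d - 2 * i) v = w"
proof -
  interpret pair: finite_dimensional_vector_space_pair_1 scale Basis scale ..
  let ?tau_op = "tau_op i (d - 2 * i)"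
  have id: "i + (d - 2 * i) = d - i" using i by simp
  have "v = 0" if "v \<in> U i" "?tau_op v = 0" for v
    using tau_op_inj[of v i "d - 2 * i"] that i by simp
  then have "dim (?tau_op ` U i) = dim (U i)" by (intro dim_image_of_trivial_kernel subspace_U endo_tau_op)
  moreover have "subspace (?tau_op ` U i)" by (rule pair.linear_subspace_image[OF endo_tau_op subspace_U])
  moreover have "?tau_op ` U i \<subseteq> U (d - i)" using tau_op_U[of _ i "d - 2 * i"] id by auto
  ultimately have "?tau_op ` U i = U (d - i)"
    using dim_U_reverse[of i] i by (intro subspace_dim_equal subspace_U) auto
  then have "w \<in> ?tau_op ` U i" using w by simp
  then show thesis using that by (auto elim!: imageE)
qed

lemma subspace_K: "subspace (K i)"
  unfolding K_def U_down_def by (intro subspace_inter subspace_U rev.subspace_U)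

text \<open>
  So \<open>K i\<close> consists of the vectors of \<open>U i\<close> from which the ladder stops as early as injectivity permits.
\<close>
lemma K_iff:
  assumes "2 * i \<le> d"
  shows "v \<in> K i \<longleftrightarrow> v \<in> U i \<and> tau_op i (Suc (d - 2 * i)) v = 0"
proof (intro iffI conjI)
  assume v: "v \<in> K i"
  then show "v \<in> U i" by (simp add: K_def)
  show "tau_op i (Suc (d - 2 * i)) v = 0"
  proof (rule zero_by_components)
    fix h assume h: "h \<le> d"
    show "E h (tau_op i (Suc (d - 2 * i)) v) = 0"
    proof (cases "i \<le> h \<and> h \<le> d - i")
      case True
      then have "(\<Prod>l<Suc (d - 2 * i). \<theta> h - \<theta> (i + l)) = 0"
        using assms by (intro prod_zero) (auto intro!: bexI[of _ "h - i"])
      then show ?thesis unfolding tau_op_def E_newton[OF h] by (simp del: prod.lessThan_Suc)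
    next
      case False
      have "E h v = 0"
      proof (cases "h < i")
        case True
        then show ?thesis using v h by (auto simp: K_def U_def high_def)
      next
        case 2: False
        then have "d - h < i" "d - (d - h) = h" using False h by auto
        then show ?thesis using v by (auto simp: K_def U_down_def rev.U_def rev.high_def dest!: spec[of _ "d - h"])
      qed
      then show ?thesis unfolding tau_op_def E_newton[OF h] by simp
    qed
  qed
next
  assume v: "v \<in> U i \<and> tau_op i (Suc (d - 2 * i)) v = 0"
  have "E (d - h) v = 0" if h: "h < i" for h
  proof (rule newton_eq_0_imp_component[of _ "\<lambda>h. \<theta> (i + h)" "Suc (d - 2 * i)"])
    fix l assume "l < Suc (d - 2 * i)"
    then have "i + l < d - h" "i + l \<le> d" using h assms by linarith+
    then show "\<theta> (i + l) \<noteq> \<theta> (d - h)" using inj_onD[OF \<theta>_inj, of "i + l" "d - h"] by auto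
  qed (use v in \<open>auto simp: tau_op_def\<close>)
  then show "v \<in> K i" using v by (auto simp: K_def U_down_def rev.U_def U_def rev.high_def)
qed

text \<open>
  Every vector of \<open>U j\<close> splits into an element of \<open>K j\<close> and one raised from \<open>U (j - 1)\<close>: push it to \<open>U (d - j + 1)\<close>,
  which is the isomorphic image of \<open>U (j - 1)\<close>, and subtract what comes from there.
\<close>
lemma U_ladder_lower:
  "2 * j \<le> d \<Longrightarrow> u \<in> U j \<Longrightarrow> \<exists>k. (\<forall>i\<le>j. k i \<in> K i) \<and> u = (\<Sum>i\<le>j. tau_op i (j - i) (k i))"
proof (induction j arbitrary: u)
  case 0
  then have "u \<in> K 0" by (auto simp: K_def U_down_def rev.U_def U_def rev.high_0)
  then show ?case by (intro exI[of _ "\<lambda>_. u"]) (simp add: tau_op_0)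
next
  case (Suc j)
  define m where "m = d - 2 * Suc j"
  obtain e where "d = 2 * Suc j + e" using le_Suc_ex[OF Suc.prems(1)] by blast
  then have m: "Suc j + Suc m = d - j" "Suc (Suc m) = d - 2 * j" "2 * j \<le> d"
    unfolding m_def by simp_all
  have "tau_op (Suc j) (Suc m) u \<in> U (d - j)"
    using tau_op_U[OF Suc.prems(2), of "Suc m"] unfolding m(1) .
  then obtain w where w: "w \<in> U j" "tau_op j (Suc (Suc m)) w = tau_op (Suc j) (Suc m) u"
    unfolding m(2) by (rule tau_op_surj[OF m(3)])
  have "u - tau_op j 1 w \<in> U (Suc j)"
    using Suc.prems(2) tau_op_U[OF w(1), of 1] by (auto intro: subspace_diff[OF subspace_U])
  moreover have "tau_op (Suc j) (Suc m) (u - tau_op j 1 w) = 0"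
    using w(2) tau_op_tau_op[of j 1 "Suc j" "Suc m" w] by (simp add: endo_diff[OF endo_tau_op])
  ultimately have rest: "u - tau_op j 1 w \<in> K (Suc j)" using K_iff[OF Suc.prems(1)] unfolding m_def by blast
  obtain k where k: "\<forall>i\<le>j. k i \<in> K i" "w = (\<Sum>i\<le>j. tau_op i (j - i) (k i))"
    using Suc.IH[OF m(3) w(1)] by blast
  have "tau_op j 1 w = (\<Sum>i\<le>j. tau_op i (Suc j - i) (k i))"
    unfolding k(2) endo_sum[OF endo_tau_op] by (intro sum.cong) (auto simp: tau_op_tau_op Suc_diff_le)
  also have "\<dots> = (\<Sum>i\<le>j. tau_op i (Suc j - i) ((k(Suc j := u - tau_op j 1 w)) i))"
    by (intro sum.cong) auto
  finally have "u = (\<Sum>i\<le>Suc j. tau_op i (Suc j - i) ((k(Suc j := u - tau_op j 1 w)) i))"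
    by (simp add: tau_op_0)
  moreover have "\<forall>i\<le>Suc j. (k(Suc j := u - tau_op j 1 w)) i \<in> K i" using k(1) rest by auto
  ultimately show ?case by (intro exI[of _ "k(Suc j := u - tau_op j 1 w)"] conjI)
qed

lemma U_ladder:
  assumes j: "j \<le> d" and u: "u \<in> U j"
  shows "\<exists>k. (\<forall>i\<le>min j (d - j). k i \<in> K i) \<and> u = (\<Sum>i\<le>min j (d - j). tau_op i (j - i) (k i))"
proof (cases "2 * j \<le> d")
  case True
  then have "min j (d - j) = j" by simp
  then show ?thesis using U_ladder_lower[OF True u] by (simp only:)
next
  case False
  define r where "r = d - j"
  have r: "2 * r \<le> d" "d - r = j" "min j (d - j) = r" using False j by (auto simp: r_def)
  obtain w where w: "w \<in> U r" "tau_op r (d - 2 * r) w = u" using tau_op_surj[OF r(1)] u r(2) by auto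
  obtain k where k: "\<forall>i\<le>r. k i \<in> K i" "w = (\<Sum>i\<le>r. tau_op i (r - i) (k i))"
    using U_ladder_lower[OF r(1) w(1)] by blast
  have "u = (\<Sum>i\<le>r. tau_op i (j - i) (k i))"
    unfolding w(2)[symmetric] k(2) endo_sum[OF endo_tau_op]
  proof (intro sum.cong refl)
    fix i assume "i \<in> {..r}"
    then have "i + (r - i) = r" "(r - i) + (d - 2 * r) = j - i" using r by auto
    then show "tau_op r (d - 2 * r) (tau_op i (r - i) (k i)) = tau_op i (j - i) (k i)"
      using tau_op_tau_op[of i "r - i" r "d - 2 * r" "k i"] by (simp only:)
  qed
  then show ?thesis using k(1) r(3) by auto
qed

lemma tau_op_K_eq_0:
  assumes "2 * i \<le> d" "v \<in> K i" "d - 2 * i < m"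
  shows "tau_op i m v = 0"
proof -
  have "tau_op i m v = tau_op (i + Suc (d - 2 * i)) (m - Suc (d - 2 * i)) (tau_op i (Suc (d - 2 * i)) v)"
    using assms(3) by (subst tau_op_tau_op) auto
  then show ?thesis using assms K_iff endo_0[OF endo_tau_op] by simp
qed

text \<open>
  Raise a vanishing combination to \<open>U (d - i)\<close>, where \<open>i\<close> is the smallest index not yet treated. All ladders that start
  later have stopped by then, and on the remaining term raising is injective.
\<close>
lemma U_ladder_indep:
  assumes j: "j \<le> d" and k: "\<And>i. i \<le> min j (d - j) \<Longrightarrow> k i \<in> K i"
    and z: "(\<Sum>i\<le>min j (d - j). tau_op i (j - i) (k i)) = 0" and i: "i \<le> min j (d - j)"
  shows "k i = 0"
  using i
proof (induction i rule: less_induct)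
  case (less i)
  let ?r = "min j (d - j)"
  have "0 = tau_op j (d - i - j) (\<Sum>l\<le>?r. tau_op l (j - l) (k l))" using z endo_0[OF endo_tau_op] by simp
  also have "\<dots> = (\<Sum>l\<le>?r. tau_op l (d - i - l) (k l))"
    unfolding endo_sum[OF endo_tau_op]
  proof (intro sum.cong refl)
    fix l assume "l \<in> {..?r}"
    then have "l + (j - l) = j" "(j - l) + (d - i - j) = d - i - l" using less.prems j by auto
    then show "tau_op j (d - i - j) (tau_op l (j - l) (k l)) = tau_op l (d - i - l) (k l)"
      using tau_op_tau_op[of l "j - l" j "d - i - j" "k l"] by (simp only:)
  qed
  also have "\<dots> = (\<Sum>l\<le>?r. if l = i then tau_op i (d - i - i) (k i) else 0)"
  proof (intro sum.cong refl)
    fix l assume l: "l \<in> {..?r}"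
    consider "l < i" | "l = i" | "i < l" by linarith
    then show "tau_op l (d - i - l) (k l) = (if l = i then tau_op i (d - i - i) (k i) else 0)"
    proof cases
      case 1
      then have "k l = 0" using less l by simp
      then show ?thesis using 1 by (simp add: endo_0[OF endo_tau_op])
    next
      case 3
      have "2 * l \<le> d" "d - 2 * l < d - i - l" using l 3 j by auto
      moreover have "k l \<in> K l" using k l by simp
      ultimately have "tau_op l (d - i - l) (k l) = 0" using tau_op_K_eq_0 by blast
      then show ?thesis using 3 by simp
    qed simp
  qed
  finally have "tau_op i (d - i - i) (k i) = 0" using less.prems by simp
  moreover have "k i \<in> U i" using k[OF less.prems] by (simp add: K_def)
  moreover have "i + (i + (d - i - i)) \<le> d" using less.prems j by auto
  ultimately show ?case using tau_op_inj by blast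
qed

text \<open>
  Pairs \<open>(j, i)\<close> with \<open>i \<le> j \<le> d - i\<close>, with the level \<open>j\<close> first so that sums over levels are iterated sums.
\<close>
definition ladder_index :: "(nat \<times> nat) set" where
  "ladder_index = (SIGMA j:{..d}. {..min j (d - j)})"

lemma finite_ladder_index: "finite ladder_index"
  by (simp add: ladder_index_def)

lemma mem_ladder_index: "(j, i) \<in> ladder_index \<longleftrightarrow> i \<le> j \<and> i \<le> d \<and> j \<le> d - i"
  by (auto simp: ladder_index_def)

lemma ladder_span:
  "\<exists>k. (\<forall>p\<in>ladder_index. k p \<in> K (snd p)) \<and> v = (\<Sum>p\<in>ladder_index. tau_op (snd p) (fst p - snd p) (k p))"
proof -
  obtain u where u: "\<forall>j\<le>d. u j \<in> U j" "v = (\<Sum>j\<le>d. u j)" using U_sum_ex by blast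
  then have "\<forall>j. \<exists>k. j \<le> d \<longrightarrow> (\<forall>i\<le>min j (d - j). k i \<in> K i) \<and> u j = (\<Sum>i\<le>min j (d - j). tau_op i (j - i) (k i))"
    using U_ladder by blast
  then obtain k where k: "\<And>j. j \<le> d \<Longrightarrow> (\<forall>i\<le>min j (d - j). k j i \<in> K i) \<and> u j = (\<Sum>i\<le>min j (d - j). tau_op i (j - i) (k j i))"
    by metis
  have "v = (\<Sum>j\<le>d. \<Sum>i\<le>min j (d - j). tau_op i (j - i) (k j i))"
    unfolding u(2) using k by (intro sum.cong) auto
  also have "\<dots> = (\<Sum>(j, i)\<in>ladder_index. tau_op i (j - i) (k j i))"
    unfolding ladder_index_def by (intro sum.Sigma) auto
  finally show ?thesis
    using k by (intro exI[of _ "\<lambda>(j, i). k j i"]) (auto simp: ladder_index_def case_prod_unfold)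
qed

lemma ladder_indep:
  assumes k: "\<forall>p\<in>ladder_index. k p \<in> K (snd p)"
    and z: "(\<Sum>p\<in>ladder_index. tau_op (snd p) (fst p - snd p) (k p)) = 0" and p: "p \<in> ladder_index"
  shows "k p = 0"
proof -
  obtain j i where ji: "p = (j, i)" by (rule prod.exhaust)
  have j: "j \<le> d" "i \<le> min j (d - j)" using p unfolding ji ladder_index_def by simp_all
  define u where "u j = (\<Sum>i\<le>min j (d - j). tau_op i (j - i) (k (j, i)))" for j
  have "(\<Sum>j\<le>d. u j) = (\<Sum>(j, i)\<in>ladder_index. tau_op i (j - i) (k (j, i)))"
    unfolding ladder_index_def u_def by (intro sum.Sigma) auto
  then have "(\<Sum>j\<le>d. u j) = 0" using z by (simp add: case_prod_unfold)
  moreover have "u j \<in> U j" if "j \<le> d" for j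
    unfolding u_def
  proof (intro subspace_sum[OF subspace_U])
    fix i assume i: "i \<in> {..min j (d - j)}"
    then have "k (j, i) \<in> U i" using k that by (force simp: ladder_index_def K_def)
    then show "tau_op i (j - i) (k (j, i)) \<in> U j" using tau_op_U[of "k (j, i)" i "j - i"] i by simp
  qed
  ultimately have "u j = 0"
    using direct_U j(1) unfolding direct_decomposition_def by blast
  then show ?thesis
    unfolding ji using k j by (intro U_ladder_indep[of j "\<lambda>i. k (j, i)"]) (auto simp: u_def ladder_index_def)
qed

lemma endo_eqI:
  assumes f: "endo f" and g: "endo g"
    and eq: "\<And>i m v. 2 * i + m \<le> d \<Longrightarrow> v \<in> K i \<Longrightarrow> f (tau_op i m v) = g (tau_op i m v)"
  shows "f = g"
proof
  fix v
  obtain k where k: "\<forall>p\<in>ladder_index. k p \<in> K (snd p)" "v = (\<Sum>p\<in>ladder_index. tau_op (snd p) (fst p - snd p) (k p))"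
    using ladder_span by blast
  have "f (tau_op (snd p) (fst p - snd p) (k p)) = g (tau_op (snd p) (fst p - snd p) (k p))" if "p \<in> ladder_index" for p
  proof (rule eq)
    show "2 * snd p + (fst p - snd p) \<le> d" using that by (cases p) (auto simp: mem_ladder_index)
  qed (use k that in auto)
  then show "f v = g v" unfolding k(2) endo_sum[OF f] endo_sum[OF g] by simp
qed

section \<open>Translation of the definitions\<close>

lemma split_U_eq: "i \<le> d \<Longrightarrow> split_U d E Es i = U i"
  unfolding split_U_def U_def
  by (auto simp: range_E_sum_iff dual.range_E_sum_iff low_def high_def Suc_le_eq)

lemma rev_high_iff: "v \<in> rev.high i \<longleftrightarrow> (\<forall>h\<le>d. d < h + i \<longrightarrow> E h v = 0)"
proof
  assume "v \<in> rev.high i"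
  then have *: "h \<le> d \<Longrightarrow> h < i \<Longrightarrow> E (d - h) v = 0" for h by (simp add: rev.high_def)
  show "\<forall>h\<le>d. d < h + i \<longrightarrow> E h v = 0"
  proof (intro allI impI)
    fix h assume h: "h \<le> d" "d < h + i"
    then have "d - h < i" "d - (d - h) = h" by linarith+
    then show "E h v = 0" using *[of "d - h"] by simp
  qed
next
  assume *: "\<forall>h\<le>d. d < h + i \<longrightarrow> E h v = 0"
  have "E (d - h) v = 0" if "h \<le> d" "h < i" for h
  proof -
    have "d - h \<le> d" "d < d - h + i" using that by linarith+
    then show ?thesis using * by blast
  qed
  then show "v \<in> rev.high i" by (simp add: rev.high_def)
qed

lemma split_U_down_eq: "i \<le> d \<Longrightarrow> split_U_down d E Es i = U_down i"
  unfolding split_U_down_def U_down_def rev.U_def set_eq_iff Int_iff rev_high_iff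
  by (auto simp: range_E_sum_iff dual.range_E_sum_iff low_def Suc_le_eq)

lemma split_K_eq: "2 * i \<le> d \<Longrightarrow> split_K d E Es i = K i"
  unfolding split_K_def U_down_def rev.U_def K_def set_eq_iff Int_iff rev_high_iff U_def
  by (auto simp: range_E_sum_iff dual.range_E_sum_iff low_def high_def Suc_le_eq)

lemma range_E_eigenspace:
  assumes i: "i \<le> d"
  shows "range (E i) = eigenspace A (\<theta> i)"
proof (intro equalityI subsetI)
  fix v assume "v \<in> eigenspace A (\<theta> i)"
  then have v: "A v = \<theta> i *s v" by (simp add: eigenspace_def)
  have "E h v = 0" if "h \<le> d" "h \<noteq> i" for h
  proof -
    have "(\<theta> h - \<theta> i) *s E h v = 0"
      using E_A[OF that(1), of v] by (auto simp: v endo_scale[OF endo_E[OF that(1)]] scale_left_diff_distrib)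
    moreover have "\<theta> h \<noteq> \<theta> i" using inj_onD[OF \<theta>_inj, of h i] that i by auto
    ultimately show ?thesis by simp
  qed
  then have "(\<Sum>h\<le>d. E h v) = E i v" using i by (simp add: sum.remove[of "{..d}" i])
  then show "v \<in> range (E i)" by (metis sum_E rangeI)
qed (use i in \<open>auto simp: eigenspace_def A_E\<close>)

lemma td_eigenvalue_eq:
  assumes i: "i \<le> d"
  shows "td_eigenvalue A E i = \<theta> i"
  unfolding td_eigenvalue_def
proof (rule the_equality)
  show "range (E i) = eigenspace A (\<theta> i)" by (rule range_E_eigenspace[OF i])
  fix c assume c: "range (E i) = eigenspace A c"
  obtain v where v: "E i v \<noteq> 0" using E_nonzero[OF i] by blast
  have "E i v \<in> eigenspace A c" using c by blast
  then have "(c - \<theta> i) *s E i v = 0" using A_E[OF i, of v] by (auto simp: eigenspace_def scale_left_diff_distrib)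
  then show "c = \<theta> i" using v by simp
qed

lemma poly_end_tau:
  assumes "2 * i + m \<le> d"
  shows "poly_end (tau A E i (int (i + m))) A v = tau_op i m v"
proof -
  have "tau A E i (int (i + m)) = (\<Prod>h\<in>{i..<i + m}. [:- \<theta> h, 1:])"
    unfolding tau_def using assms by (auto simp: td_eigenvalue_eq nat_add_distrib intro!: prod.cong)
  then show ?thesis using poly_end_prod[OF endo_A] by (simp add: tau_op_def)
qed

end

section \<open>The recurrence of the eigenvalues\<close>

lemma (in spectral_family) newton_interpolant:
  "(\<Sum>k\<le>d. a k *s newton A \<theta> k (E i v)) = (\<Sum>k\<le>d. a k * (\<Prod>h<k. \<theta> i - \<theta> h)) *s E i v" if "i \<le> d"
  unfolding newton_eigenvector[OF endo_A A_E[OF that]] by (simp add: scale_sum_left)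

context td_system
begin

text \<open>
  Modulo \<open>low i\<close> the dual map acts on \<open>low (i + 1)\<close> as its \<open>i\<close>-th eigenvalue, which is not the \<open>0\<close>-th one.
\<close>
lemma low_Suc_descend:
  assumes i: "1 \<le> i" "i \<le> d" and v: "v \<in> low (Suc i)" and "As v - \<theta>s 0 *s v \<in> low i"
  shows "v \<in> low i"
proof -
  have "Es i (As v - \<theta>s 0 *s v) = 0" using assms(4) i by (simp add: low_def)
  then have "(\<theta>s i - \<theta>s 0) *s Es i v = 0"
    using i by (simp add: endo_diff[OF dual.endo_E] endo_scale[OF dual.endo_E] dual.E_A scale_left_diff_distrib)
  moreover have "\<theta>s i \<noteq> \<theta>s 0" using inj_onD[OF dual.\<theta>_inj, of i 0] i by auto
  ultimately have "Es i v = 0" by simp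
  then show ?thesis using v by (auto simp: low_def le_less Suc_le_eq)
qed

text \<open>
  Between the \<open>i\<close>-th and the \<open>j\<close>-th eigenspace of \<open>A\<close> both sides are multiples of \<open>As\<close>, by
  \<open>\<theta>\<^sub>j \<theta>\<^sub>i (\<theta>\<^sub>j - \<theta>\<^sub>i)\<close> and \<open>z\<^sub>j - z\<^sub>i\<close>. Only neighbouring eigenspaces matter, and for these the two
  factors agree by the choice of \<open>z\<close>.
\<close>
lemma As_A_commutation:
  assumes z: "\<And>i. i < d \<Longrightarrow> z (Suc i) - z i = \<theta> i * \<theta> (Suc i) * (\<theta> (Suc i) - \<theta> i)"
    and Z: "endo Z" "\<And>i v. i \<le> d \<Longrightarrow> Z (E i v) = z i *s E i v"
  shows "A (A (As (A v))) - A (As (A (A v))) = Z (As v) - As (Z v)"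
proof -
  have EZ: "E j (Z v) = z j *s E j v" if j: "j \<le> d" for j v
  proof -
    have "E j (Z v) = (\<Sum>i\<le>d. if i = j then z j *s E j v else 0)"
      unfolding E_comp[OF Z(1) j, of v]
      using j by (intro sum.cong) (auto simp: Z(2) endo_scale[OF endo_E] E_E)
    then show ?thesis using j by simp
  qed
  have coeff: "\<theta> j * \<theta> j * \<theta> i - \<theta> j * \<theta> i * \<theta> i = z j - z i" if "i \<le> d" "j \<le> d" "\<not> (Suc i < j \<or> Suc j < i)" for i j
  proof -
    have "i = j \<or> j = Suc i \<or> i = Suc j" using that(3) by linarith
    then consider "i = j" | "j = Suc i" | "i = Suc j" by blast
    then show ?thesis
    proof cases
      case 2
      then show ?thesis using z[of i] that by (simp add: algebra_simps)
    next
      case 3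
      then have "z i - z j = \<theta> j * \<theta> i * (\<theta> i - \<theta> j)" using z[of j] that by simp
      then show ?thesis by algebra
    qed simp
  qed
  have comm: "A (A (As (A w))) - A (As (A (A w))) = Z (As w) - As (Z w)" if w: "w = E i v" "i \<le> d" for w i
  proof -
    have Aw: "A w = \<theta> i *s w" and Zw: "Z w = z i *s w" using w A_E Z(2) by auto
    have "E j (A (A (As (A w))) - A (As (A (A w))) - (Z (As w) - As (Z w))) = 0" if j: "j \<le> d" for j
    proof -
      have "E j (A (A (As (A w))) - A (As (A (A w))) - (Z (As w) - As (Z w)))
          = (\<theta> j * \<theta> j * \<theta> i - \<theta> j * \<theta> i * \<theta> i - (z j - z i)) *s E j (As w)"
        using j by (simp add: Aw Zw endo_scale[OF endo_A] endo_scale[OF dual.endo_A] endo_diff[OF endo_E]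
            endo_scale[OF endo_E] E_A EZ scale_left_diff_distrib mult_ac)
      also have "\<dots> = 0"
        using coeff[OF w(2) j] E_As_E[OF j w(2)] w by (cases "Suc i < j \<or> Suc j < i") auto
      finally show ?thesis .
    qed
    then have "A (A (As (A w))) - A (As (A (A w))) - (Z (As w) - As (Z w)) = 0"
      by (rule zero_by_components)
    then show ?thesis by simp
  qed
  let ?L = "\<lambda>w. A (A (As (A w))) - A (As (A (A w))) - (Z (As w) - As (Z w))"
  have L: "endo ?L"
    by (intro endoI) (simp_all add: endo_add[OF endo_A] endo_add[OF dual.endo_A] endo_add[OF Z(1)]
        endo_scale[OF endo_A] endo_scale[OF dual.endo_A] endo_scale[OF Z(1)] scale_right_diff_distrib)
  have "?L v = ?L (\<Sum>i\<le>d. E i v)" by (simp only: sum_E)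
  also have "\<dots> = 0" unfolding endo_sum[OF L] using comm by (intro sum.neutral) auto
  finally show ?thesis by simp
qed

text \<open>
  The polynomial in \<open>A\<close> with eigenvalues \<open>z\<^sub>i\<close> has degree at most three. For \<open>v\<close> in the first eigenspace of the dual map,
  \<open>As_A_commutation\<close> puts \<open>(As - \<theta>s\<^sub>0) Z v\<close> into \<open>low 4\<close>, and descent puts \<open>Z v\<close> there too. The
  Newton terms \<open>a\<^sub>k \<tau>\<^sub>0\<^sub>k(A) v\<close> of \<open>Z v\<close> lie in the different summands \<open>U k\<close>, and \<open>\<tau>\<^sub>0\<^sub>k(A) v\<close> is
  nonzero, so \<open>a\<^sub>k = 0\<close> for \<open>k \<ge> 4\<close>.
\<close>
lemma eigenvalue_difference_cubic:
  assumes d: "3 \<le> d"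
  obtains a0 a1 a2 a3 where
    "\<And>i. i < d \<Longrightarrow> \<theta> i * \<theta> (Suc i) * (\<theta> (Suc i) - \<theta> i) =
      (a0 + a1 * \<theta> (Suc i) + a2 * (\<theta> (Suc i))\<^sup>2 + a3 * (\<theta> (Suc i)) ^ 3) -
      (a0 + a1 * \<theta> i + a2 * (\<theta> i)\<^sup>2 + a3 * (\<theta> i) ^ 3)"
proof -
  define z where "z i = (\<Sum>h<i. \<theta> h * \<theta> (Suc h) * (\<theta> (Suc h) - \<theta> h))" for i
  obtain a where a: "\<And>i. i \<le> d \<Longrightarrow> (\<Sum>k\<le>d. a k * (\<Prod>h<k. \<theta> i - \<theta> h)) = z i"
    using newton_interpolation by blast
  define Z where "Z v = (\<Sum>k\<le>d. a k *s newton A \<theta> k v)" for v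
  have Z: "endo Z" unfolding Z_def by (intro endo_sum_fun endo_scaled endo_newton endo_A)
  have ZE: "Z (E i v) = z i *s E i v" if "i \<le> d" for i v
    unfolding Z_def newton_interpolant[OF that] a[OF that] ..
  obtain w where w: "Es 0 w \<noteq> 0" using dual.E_nonzero by blast
  define v where "v = Es 0 w"
  have v1: "v \<in> low 1" by (auto simp: v_def low_def dual.E_E)
  have Asv: "As v = \<theta>s 0 *s v" by (simp add: v_def dual.A_E)
  have As_low': "As x \<in> low (Suc i)" if "x \<in> low (Suc i)" for x i
    using that by (auto simp: low_def dual.E_A)
  have "A (A (As (A v))) - A (As (A (A v))) \<in> low 4"
  proof (rule subspace_diff[OF subspace_low])
    have "A v \<in> low (Suc 1)" using A_low v1 by blast
    then have "As (A v) \<in> low (Suc 1)" "A (A v) \<in> low (Suc (Suc 1))" using A_low As_low' by blast+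
    then have "A (As (A v)) \<in> low (Suc (Suc 1))" "As (A (A v)) \<in> low (Suc (Suc 1))" using A_low As_low' by blast+
    then have "A (A (As (A v))) \<in> low (Suc (Suc (Suc 1)))" "A (As (A (A v))) \<in> low (Suc (Suc (Suc 1)))" using A_low by blast+
    then show "A (A (As (A v))) \<in> low 4" "A (As (A (A v))) \<in> low 4" by (simp_all add: eval_nat_numeral)
  qed
  moreover have "A (A (As (A v))) - A (As (A (A v))) = - (As (Z v) - \<theta>s 0 *s Z v)"
    using As_A_commutation[OF _ Z ZE, of v] by (simp add: z_def Asv endo_scale[OF Z])
  ultimately have comm: "As (Z v) - \<theta>s 0 *s Z v \<in> low 4"
    using subspace_neg[OF subspace_low] by fastforce
  have Zlow: "Z v \<in> low (Suc (d - n))" if "n \<le> d - 3" for n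
    using that
  proof (induction n)
    case (Suc n)
    have "As (Z v) - \<theta>s 0 *s Z v \<in> low (d - n)"
    proof (rule subsetD[OF low_mono comm])
      show "4 \<le> d - n" using Suc.prems by linarith
    qed
    moreover have n: "1 \<le> d - n" "d - n = Suc (d - Suc n)" "n \<le> d - 3" using Suc.prems by linarith+
    ultimately have "Z v \<in> low (d - n)"
      using low_Suc_descend[OF n(1) diff_le_self Suc.IH[OF n(3)]] by blast
    then show ?case unfolding n(2) .
  qed (simp add: low_above)
  have "Z v \<in> low 4" using Zlow[of "d - 3"] d by (simp add: eval_nat_numeral)
  have vU: "v \<in> U 0" using v1 by (simp add: U_def high_0)
  have a0: "a k = 0" if k: "4 \<le> k" "k \<le> d" for k
  proof -
    have "a k *s tau_op 0 k v = 0"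
    proof (rule U_components_low[of "\<lambda>k. a k *s tau_op 0 k v" 4])
      show "a i *s tau_op 0 i v \<in> U i" for i using tau_op_U[OF vU, of i] subspace_scale[OF subspace_U] by simp
      show "(\<Sum>i\<le>d. a i *s tau_op 0 i v) \<in> low 4" using \<open>Z v \<in> low 4\<close> by (simp add: Z_def tau_op_def)
    qed (use k in auto)
    moreover have "tau_op 0 k v \<noteq> 0" using tau_op_inj[OF vU, of k] k w by (auto simp: v_def)
    ultimately show ?thesis by simp
  qed
  have z3: "z i = a 0 + a 1 * (\<theta> i - \<theta> 0) + a 2 * ((\<theta> i - \<theta> 0) * (\<theta> i - \<theta> 1))
      + a 3 * ((\<theta> i - \<theta> 0) * (\<theta> i - \<theta> 1) * (\<theta> i - \<theta> 2))" if "i \<le> d" for i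
  proof -
    have "z i = (\<Sum>k\<le>d. a k * (\<Prod>h<k. \<theta> i - \<theta> h))" using a that by simp
    also have "\<dots> = (\<Sum>k\<le>3. a k * (\<Prod>h<k. \<theta> i - \<theta> h))"
      using d a0 by (intro sum.mono_neutral_right) auto
    finally show ?thesis by (simp add: eval_nat_numeral)
  qed
  show thesis
  proof (rule that)
    fix i assume i: "i < d"
    have "\<theta> i * \<theta> (Suc i) * (\<theta> (Suc i) - \<theta> i) = z (Suc i) - z i" by (simp add: z_def)
    also have "\<dots> = (0 + (a 1 - a 2 * (\<theta> 0 + \<theta> 1) + a 3 * (\<theta> 0 * \<theta> 1 + \<theta> 0 * \<theta> 2 + \<theta> 1 * \<theta> 2)) * \<theta> (Suc i)
        + (a 2 - a 3 * (\<theta> 0 + \<theta> 1 + \<theta> 2)) * (\<theta> (Suc i))\<^sup>2 + a 3 * (\<theta> (Suc i)) ^ 3) -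
      (0 + (a 1 - a 2 * (\<theta> 0 + \<theta> 1) + a 3 * (\<theta> 0 * \<theta> 1 + \<theta> 0 * \<theta> 2 + \<theta> 1 * \<theta> 2)) * \<theta> i
        + (a 2 - a 3 * (\<theta> 0 + \<theta> 1 + \<theta> 2)) * (\<theta> i)\<^sup>2 + a 3 * (\<theta> i) ^ 3)"
      using i by (simp add: z3 algebra_simps power2_eq_square power3_eq_cube)
    finally show "\<theta> i * \<theta> (Suc i) * (\<theta> (Suc i) - \<theta> i) = \<dots>" .
  qed
qed

text \<open>
  Dividing the cubic identity by \<open>\<theta>\<^bsub>i+1\<^esub> - \<theta>\<^sub>i\<close> gives a symmetric quadratic relation between neighbours. The difference of
  its instances for \<open>(\<theta>\<^bsub>k-1\<^esub>, \<theta>\<^sub>k)\<close> and \<open>(\<theta>\<^sub>k, \<theta>\<^bsub>k+1\<^esub>)\<close>, divided by \<open>\<theta>\<^bsub>k+1\<^esub> - \<theta>\<^bsub>k-1\<^esub>\<close>, is linear. The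
  coefficient \<open>a\<^sub>3\<close> is nonzero, as otherwise \<open>\<theta>\<^sub>1 = \<theta>\<^sub>2\<close>. For \<open>d \<le> 2\<close> there is at most one
  condition, which \<open>g\<close> alone can meet.
\<close>
lemma eigenvalue_recurrence:
  "\<exists>b g. \<forall>k. 0 < k \<longrightarrow> k < d \<longrightarrow> \<theta> (k - 1) + \<theta> (k + 1) = b * \<theta> k + g"
proof (cases "3 \<le> d")
  case False
  then show ?thesis
    by (intro exI[of _ 0] exI[of _ "\<theta> 0 + \<theta> 2"]) (auto simp: eval_nat_numeral less_Suc_eq not_le)
next
  case True
  obtain a0 a1 a2 a3 where cubic: "\<And>i. i < d \<Longrightarrow> \<theta> i * \<theta> (Suc i) * (\<theta> (Suc i) - \<theta> i) =
      (a0 + a1 * \<theta> (Suc i) + a2 * (\<theta> (Suc i))\<^sup>2 + a3 * (\<theta> (Suc i)) ^ 3) -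
      (a0 + a1 * \<theta> i + a2 * (\<theta> i)\<^sup>2 + a3 * (\<theta> i) ^ 3)"
    using eigenvalue_difference_cubic[OF True] by metis
  have quad: "x * y = a1 + a2 * (x + y) + a3 * (x\<^sup>2 + x * y + y\<^sup>2)"
    if "i < d" "x = \<theta> i" "y = \<theta> (Suc i)" for i x y
  proof -
    have "x \<noteq> y" using inj_onD[OF \<theta>_inj, of i "Suc i"] that by auto
    moreover have "(y - x) * (x * y) = (y - x) * (a1 + a2 * (x + y) + a3 * (x\<^sup>2 + x * y + y\<^sup>2))"
      using cubic[OF that(1), folded that(2,3)] by (simp add: algebra_simps power2_eq_square power3_eq_cube)
    ultimately show ?thesis by simp
  qed
  have lin: "y = a2 + a3 * (x + y + w)"
    if n: "Suc n < d" and xyw: "x = \<theta> n" "y = \<theta> (Suc n)" "w = \<theta> (Suc (Suc n))" for n x y w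
  proof -
    have "\<theta> n \<noteq> \<theta> (Suc (Suc n))" using inj_onD[OF \<theta>_inj, of n "Suc (Suc n)"] n by auto
    then have "w - x \<noteq> 0" using xyw by simp
    have "x * y = a1 + a2 * (x + y) + a3 * (x\<^sup>2 + x * y + y\<^sup>2)"
      using quad[OF Suc_lessD[OF n] xyw(1,2)] .
    moreover have "y * w = a1 + a2 * (y + w) + a3 * (y\<^sup>2 + y * w + w\<^sup>2)"
      using quad[OF n xyw(2,3)] .
    ultimately have "(w - x) * y = (w - x) * (a2 + a3 * (x + y + w))" by algebra
    then show ?thesis using \<open>w - x \<noteq> 0\<close> mult_left_cancel by blast
  qed
  have "a3 \<noteq> 0"
  proof
    assume "a3 = 0"
    then have "\<theta> (Suc 0) = \<theta> (Suc (Suc 0))"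
      using lin[of 0, OF _ refl refl refl] lin[of "Suc 0", OF _ refl refl refl] True by simp
    then show False using inj_onD[OF \<theta>_inj, of "Suc 0" "Suc (Suc 0)"] True by auto
  qed
  have "\<theta> (k - 1) + \<theta> (k + 1) = (1 - a3) / a3 * \<theta> k + (- a2 / a3)" if k: "0 < k" "k < d" for k
  proof -
    obtain n where n: "k = Suc n" using k(1) gr0_conv_Suc by blast
    then have "\<theta> k = a2 + a3 * (\<theta> (k - 1) + \<theta> k + \<theta> (k + 1))"
      using lin[of n, OF _ refl refl refl] k(2) by simp
    then have "a3 * (\<theta> (k - 1) + \<theta> (k + 1)) = (1 - a3) * \<theta> k - a2" by algebra
    then have "\<theta> (k - 1) + \<theta> (k + 1) = ((1 - a3) * \<theta> k - a2) / a3"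
      using \<open>a3 \<noteq> 0\<close> by (simp add: nonzero_eq_divide_eq mult.commute)
    then show ?thesis by (simp only: diff_divide_distrib[of _ a2] times_divide_eq_left minus_divide_left[symmetric] add_uminus_conv_diff)
  qed
  then show ?thesis by blast
qed

end

section \<open>Both maps on the ladders\<close>

context td_system
begin

interpretation rev: td_system scale Basis d A "\<lambda>i. E (d - i)" "\<lambda>i. \<theta> (d - i)" As Es \<theta>s
  by (rule reverse_td_system)

text \<open>
  The two vectors come from monic polynomials of the same degree, so \<open>A\<^sup>m v\<close> cancels in their difference.
\<close>
lemma tau_op_minus_eta_op_low:
  assumes v: "v \<in> K i"
  shows "tau_op i m v - eta_op i m v \<in> low (i + m)"
proof (induction m)
  case 0
  show ?case using subspace_0[OF subspace_low] by (simp add: tau_op_def eta_op_def)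
next
  case (Suc m)
  have "tau_op i m v \<in> low (Suc (i + m))" using tau_op_U[of v i m] v by (simp add: K_def U_def)
  moreover have "eta_op i m v \<in> low (Suc (i + m))"
    using eta_op_U_down[of v i m] v by (simp add: K_def U_down_def rev.U_def)
  moreover have "tau_op i (Suc m) v - eta_op i (Suc m) v
      = A (tau_op i m v - eta_op i m v) - \<theta> (i + m) *s tau_op i m v + \<theta> (d - (i + m)) *s eta_op i m v"
    by (simp add: tau_op_def eta_op_def endo_diff[OF endo_A] algebra_simps)
  ultimately show ?case
    using A_low[OF Suc.IH]
    by (auto intro!: subspace_add[OF subspace_low] subspace_diff[OF subspace_low] subspace_scale[OF subspace_low])
qed

lemma direct_split_U: "direct_decomposition d (split_U d E Es)"
  using direct_U unfolding direct_decomposition_def by (simp add: split_U_eq)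

lemma direct_split_U_down: "direct_decomposition d (split_U_down d E Es)"
  using rev.direct_U unfolding direct_decomposition_def by (simp add: split_U_down_eq U_down_def)

lemma endo_Delta: "endo (Delta d E Es)"
proof -
  have "endo (\<lambda>v. summand_projection d (split_U_down d E Es) h (summand_projection d (split_U d E Es) h v))"
    if "h \<in> {0..d}" for h
    using endo_compose[OF endo_summand_projection[OF direct_split_U_down, of h]
        endo_summand_projection[OF direct_split_U, of h]] that
    by (simp add: comp_def)
  then show ?thesis unfolding Delta_def by (rule endo_sum_fun)
qed

text \<open>
  Both split decompositions have the flag \<open>low\<close> as partial sums, so a vector of \<open>low j\<close> has no \<open>j\<close>-th
  component in the second one.
\<close>
lemma down_projection_low:
  assumes v: "v \<in> low j" and j: "j \<le> d"
  shows "summand_projection d (split_U_down d E Es) j v = 0"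
proof -
  let ?F = "summand_projection d (split_U_down d E Es) j"
  obtain u where u: "\<forall>i\<le>d. u i \<in> rev.U i" "v = (\<Sum>i\<le>d. u i)" using rev.U_sum_ex by blast
  have "?F (u i) = 0" if i: "i \<le> d" for i
  proof -
    have "i = j \<Longrightarrow> u i = 0" using rev.U_components_low[of u j i] u v that by simp
    moreover have "?F (u i) = (if i = j then u i else 0)"
      using summand_projection_eq[OF direct_split_U_down j i] u(1) i by (simp add: split_U_down_eq U_down_def)
    ultimately show ?thesis by auto
  qed
  then show ?thesis
    unfolding u(2) endo_sum[OF endo_summand_projection[OF direct_split_U_down j]] by simp
qed

lemma Delta_tau_op:
  assumes v: "v \<in> K i" and m: "i + m \<le> d"
  shows "Delta d E Es (tau_op i m v) = eta_op i m v"
proof -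
  let ?F = "summand_projection d (split_U d E Es)"
  let ?G = "summand_projection d (split_U_down d E Es)"
  let ?j = "i + m"
  have F: "?F h (tau_op i m v) = (if h = ?j then tau_op i m v else 0)" if "h \<le> d" for h
    using summand_projection_eq[OF direct_split_U that m, of "tau_op i m v"] tau_op_U[of v i m] v m
    by (auto simp: split_U_eq K_def)
  have G0: "?G h 0 = 0" if "h \<le> d" for h
    using endo_0[OF endo_summand_projection[OF direct_split_U_down that]] .
  have "Delta d E Es (tau_op i m v) = (\<Sum>h=0..d. if h = ?j then ?G ?j (tau_op i m v) else 0)"
    unfolding Delta_def by (intro sum.cong) (auto simp: F G0)
  also have "\<dots> = ?G ?j (tau_op i m v)" using m by simp
  also have "\<dots> = ?G ?j (tau_op i m v - eta_op i m v) + ?G ?j (eta_op i m v)"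
    using endo_diff[OF endo_summand_projection[OF direct_split_U_down m]] by simp
  also have "?G ?j (tau_op i m v - eta_op i m v) = 0"
    using down_projection_low[OF tau_op_minus_eta_op_low[OF v] m] .
  also have "?G ?j (eta_op i m v) = eta_op i m v"
    using summand_projection_eq[OF direct_split_U_down m m, of "eta_op i m v"] eta_op_U_down[of v i m] v m
    by (simp add: split_U_down_eq K_def)
  finally show ?thesis by simp
qed

text \<open>The difference \<open>\<vartheta>\<^bsub>i+m\<^esub> - \<vartheta>\<^sub>i\<close>; see \<open>vartheta_diff\<close>.\<close>
definition vartheta_gap :: "nat \<Rightarrow> nat \<Rightarrow> 'a" where
  "vartheta_gap i m = (\<Sum>h<m. \<theta> (i + h) - \<theta> (d - (i + h))) / (\<theta> 0 - \<theta> d)"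

lemma vartheta_diff:
  assumes "2 * i + m \<le> d"
  shows "vartheta d A E (i + m) - vartheta d A E i = vartheta_gap i m"
proof -
  have "vartheta d A E n = (\<Sum>h<n. \<theta> h - \<theta> (d - h)) / (\<theta> 0 - \<theta> d)" if "n \<le> d" for n
    unfolding vartheta_def sum_divide_distrib using that by (intro sum.cong) (auto simp: td_eigenvalue_eq)
  moreover have "(\<Sum>h<i + m. \<theta> h - \<theta> (d - h)) = (\<Sum>h<i. \<theta> h - \<theta> (d - h)) + (\<Sum>h<m. \<theta> (i + h) - \<theta> (d - (i + h)))"
    by (induction m) (simp_all add: add.assoc)
  ultimately show ?thesis using assms by (simp add: vartheta_gap_def add_divide_distrib)
qed

lemma poly_end_tau_pred:
  assumes "2 * i + m \<le> d"
  shows "poly_end (tau A E i (int (i + m) - 1)) A v = (if m = 0 then 0 else tau_op i (m - 1) v)"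
proof (cases m)
  case 0
  then show ?thesis by (simp add: tau_def poly_end_def)
next
  case (Suc n)
  then have "int (i + m) - 1 = int (i + n)" by simp
  then show ?thesis using poly_end_tau[of i n v] assms Suc by simp
qed

text \<open>The characterization of \<open>\<Psi>\<close>, with the level written as \<open>i + m\<close>; see \<open>psi_spec_iff\<close>.\<close>
definition psi_spec :: "('b \<Rightarrow> 'b) \<Rightarrow> bool" where
  "psi_spec P \<longleftrightarrow> endo P \<and> (\<forall>i m v. 2 * i + m \<le> d \<longrightarrow> v \<in> K i \<longrightarrow>
     P (tau_op i m v) = (if m = 0 then 0 else vartheta_gap i m *s tau_op i (m - 1) v))"

lemma psi_spec_ex: "\<exists>P. psi_spec P"
proof -
  let ?h = "\<lambda>p v. if fst p = snd p then 0 else vartheta_gap (snd p) (fst p - snd p) *s tau_op (snd p) (fst p - snd p - 1) v"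
  obtain P where P: "endo P" "\<And>p v. p \<in> ladder_index \<Longrightarrow> v \<in> K (snd p) \<Longrightarrow>
      P (tau_op (snd p) (fst p - snd p) v) = ?h p v"
  proof (rule direct_sum_extension[of ladder_index "\<lambda>p. K (snd p)" "\<lambda>p. tau_op (snd p) (fst p - snd p)" ?h])
    show "endo (?h p)" for p by (cases "fst p = snd p") (simp_all add: endo_zero endo_scaled endo_tau_op)
  qed (use ladder_span ladder_indep in \<open>auto simp: subspace_K endo_tau_op finite_ladder_index\<close>)
  have "P (tau_op i m v) = (if m = 0 then 0 else vartheta_gap i m *s tau_op i (m - 1) v)"
    if "2 * i + m \<le> d" "v \<in> K i" for i m v
    using P(2)[of "(i + m, i)" v] that by (auto simp: mem_ladder_index)
  then show ?thesis using P(1) unfolding psi_spec_def by blast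
qed

lemma psi_spec_iff:
  "psi_spec P \<longleftrightarrow> endo P \<and>
     (\<forall>i j v. 2 * i \<le> d \<and> i \<le> j \<and> j \<le> d - i \<and> v \<in> split_K d E Es i \<longrightarrow>
        P (poly_end (tau A E i (int j)) A v) =
          (vartheta d A E j - vartheta d A E i) *s poly_end (tau A E i (int j - 1)) A v)"
    (is "_ \<longleftrightarrow> endo P \<and> (\<forall>i j v. ?Q i j v)")
proof -
  have Q: "?Q i (i + m) v \<longleftrightarrow> (v \<in> K i \<longrightarrow> P (tau_op i m v) = (if m = 0 then 0 else vartheta_gap i m *s tau_op i (m - 1) v))"
    if "2 * i + m \<le> d" for i m v
    using that poly_end_tau[OF that, of v] poly_end_tau_pred[OF that, of v] vartheta_diff[OF that] split_K_eq[of i]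
    by (auto simp del: of_nat_add)
  have "(\<forall>i j v. ?Q i j v) \<longleftrightarrow> (\<forall>i m v. 2 * i + m \<le> d \<longrightarrow> ?Q i (i + m) v)"
  proof (intro iffI allI impI)
    fix i j v assume all: "\<forall>i m v. 2 * i + m \<le> d \<longrightarrow> ?Q i (i + m) v"
      and ij: "2 * i \<le> d \<and> i \<le> j \<and> j \<le> d - i \<and> v \<in> split_K d E Es i"
    then have "2 * i + (j - i) \<le> d" "i + (j - i) = j" by linarith+
    then show "P (poly_end (tau A E i (int j)) A v) =
          (vartheta d A E j - vartheta d A E i) *s poly_end (tau A E i (int j - 1)) A v"
      using all[rule_format, of i "j - i" v] ij by simp
  qed blast
  then show ?thesis unfolding psi_spec_def using Q by blast
qed

lemma psi_spec_Psi: "psi_spec (Psi d A E Es)"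
proof -
  obtain P where P: "psi_spec P" using psi_spec_ex by blast
  have "Psi d A E Es = (THE P. psi_spec P)" unfolding Psi_def psi_spec_iff ..
  also have "\<dots> = P"
  proof (rule the_equality)
    show "psi_spec P" by fact
    show "P' = P" if "psi_spec P'" for P'
      using that P unfolding psi_spec_def by (intro endo_eqI) auto
  qed
  finally show ?thesis using P by simp
qed

text \<open>
  Expand \<open>\<eta>\<^sub>m\<close> in the \<open>\<tau>\<^sub>k\<close>, on which \<open>\<Psi>\<close> is known; the result is recognized by \<open>newton_coeff_shift\<close>,
  applied to the eigenvalues \<open>\<theta>\<^sub>i, ..., \<theta>\<^bsub>d-i\<^esub>\<close> continued to all integers.
\<close>
lemma Psi_eta_op:
  assumes v: "v \<in> K i" and m: "2 * i + m \<le> d"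
  shows "Psi d A E Es (eta_op i m v) = (if m = 0 then 0 else vartheta_gap i m *s eta_op i (m - 1) v)"
proof -
  note Psi = psi_spec_Psi[unfolded psi_spec_def]
  have endo_Psi: "endo (Psi d A E Es)" using Psi by blast
  have Psi_tau_op: "Psi d A E Es (tau_op i k v) = (if k = 0 then 0 else vartheta_gap i k *s tau_op i (k - 1) v)" if "k \<le> m" for k
    using Psi v m that by auto
  obtain b g where bg: "\<And>k. 0 < k \<Longrightarrow> k < d \<Longrightarrow> \<theta> (k - 1) + \<theta> (k + 1) = b * \<theta> k + g"
    using eigenvalue_recurrence by blast
  obtain t :: "int \<Rightarrow> 'a" where t0: "t 0 = \<theta> i" and t1: "t 1 = \<theta> (i + 1)" and t: "\<And>k. t (k - 1) + t (k + 1) = b * t k + g"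
    by (rule three_term_extension[where x = "\<theta> i" and y = "\<theta> (i + 1)" and b = b and g = g]) blast
  have t_eq: "t (int h) = \<theta> (i + h)" if "i + h \<le> d" for h
    using that
  proof (induction h rule: induct_nat_012)
    case (ge2 n)
    then have "t (int n) = \<theta> (i + n)" "t (int (Suc n)) = \<theta> (i + Suc n)" by simp_all
    moreover have "t (int n) + t (int (Suc (Suc n))) = b * t (int (Suc n)) + g"
      using t[of "int (Suc n)"] by (simp add: algebra_simps)
    moreover have "\<theta> (i + n) + \<theta> (i + Suc (Suc n)) = b * \<theta> (i + Suc n) + g"
      using bg[of "i + Suc n"] ge2.prems by simp
    ultimately show ?case by (metis add_left_cancel)
  qed (use t0 t1 in auto)
  define N where "N = int (d - 2 * i)"
  have u_eq: "t (N - int h) = \<theta> (d - (i + h))" if "2 * i + h \<le> d" for h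
  proof -
    have "N - int h = int (d - 2 * i - h)" "i + (d - 2 * i - h) = d - (i + h)" using that by (auto simp: N_def)
    then show ?thesis using t_eq[of "d - 2 * i - h"] by simp
  qed
  define s where "s k = t k - t (N - k)" for k
  \<comment> \<open>The antidifference of \<open>s\<close> that vanishes at \<open>0\<close>; negative \<open>k\<close> need the opposite sign.\<close>
  define c where "c k = (if 0 \<le> k then \<Sum>h\<in>{0..<k}. s h else - (\<Sum>h\<in>{k..<0}. s h))" for k
  have c0: "c 0 = 0" by (simp add: c_def)
  have c: "c (k + 1) = c k + t k - t (N - k)" for k
  proof (cases "0 \<le> k")
    case True
    then have "{0..<k + 1} = insert k {0..<k}" by auto
    then show ?thesis using True by (simp add: c_def s_def)
  next
    case False
    then have "{k..<0} = insert k {k + 1..<0}" by auto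
    then show ?thesis using False by (auto simp: c_def s_def)
  qed
  have rot: "vartheta_gap i k = c (int k) / (\<theta> 0 - \<theta> d)" if "k \<le> m" for k
  proof -
    have "(\<Sum>h<k. \<theta> (i + h) - \<theta> (d - (i + h))) = c (int k)"
      using that
    proof (induction k)
      case (Suc k)
      then show ?case using c[of "int k"] t_eq[of k] u_eq[of k] m by (simp add: add.commute)
    qed (simp add: c0)
    then show ?thesis by (simp add: vartheta_gap_def)
  qed
  let ?a = "newton_coeff t (\<lambda>h. t (N - h))"
  have expand: "eta_op i n v = (\<Sum>k\<le>n. ?a n (int k) *s tau_op i k v)" if "n \<le> m" for n
    unfolding eta_op_def tau_op_def using that m t_eq u_eq
    by (intro newton_expand endo_A) auto
  show ?thesis
  proof (cases m)
    case 0
    then show ?thesis using Psi_tau_op[of 0] by (simp add: eta_op_def tau_op_def)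
  next
    case (Suc n)
    have "Psi d A E Es (eta_op i m v) = (\<Sum>k\<le>Suc n. ?a m (int k) *s Psi d A E Es (tau_op i k v))"
      unfolding expand[OF order_refl] endo_sum[OF endo_Psi] endo_scale[OF endo_Psi]
      unfolding Suc ..
    also have "\<dots> = (\<Sum>k\<le>n. ?a m (int (Suc k)) *s (vartheta_gap i (Suc k) *s tau_op i k v))"
      using Psi_tau_op Suc by (subst sum.atMost_Suc_shift) simp
    also have "\<dots> = (\<Sum>k\<le>n. vartheta_gap i m *s (?a n (int k) *s tau_op i k v))"
    proof (intro sum.cong refl)
      fix k assume "k \<in> {..n}"
      then have "?a m (int (Suc k)) * vartheta_gap i (Suc k) = vartheta_gap i m * ?a n (int k)"
        using newton_coeff_shift[OF t c0 c, of "int k" n] rot[of "Suc k"] rot[of m] Suc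
        by (simp add: mult.commute add.commute)
      then show "?a m (int (Suc k)) *s (vartheta_gap i (Suc k) *s tau_op i k v) = vartheta_gap i m *s (?a n (int k) *s tau_op i k v)"
        by simp
    qed
    also have "\<dots> = vartheta_gap i m *s eta_op i n v"
      using expand[of n] Suc by (simp add: scale_sum_right)
    finally show ?thesis using Suc by simp
  qed
qed

lemma Delta_Psi_commute: "Delta d E Es \<circ> Psi d A E Es = Psi d A E Es \<circ> Delta d E Es"
proof (rule endo_eqI)
  note Psi = psi_spec_Psi[unfolded psi_spec_def]
  show "endo (Delta d E Es \<circ> Psi d A E Es)" "endo (Psi d A E Es \<circ> Delta d E Es)"
    using Psi endo_Delta by (simp_all add: endo_compose)
  fix i m v assume m: "2 * i + m \<le> d" and v: "v \<in> K i"
  have "Delta d E Es (Psi d A E Es (tau_op i m v)) = (if m = 0 then 0 else vartheta_gap i m *s eta_op i (m - 1) v)"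
    using Psi m v Delta_tau_op[OF v, of "m - 1"] by (simp add: endo_0[OF endo_Delta] endo_scale[OF endo_Delta])
  moreover have "Psi d A E Es (Delta d E Es (tau_op i m v)) = (if m = 0 then 0 else vartheta_gap i m *s eta_op i (m - 1) v)"
    using Delta_tau_op[OF v, of m] Psi_eta_op[OF v m] m by simp
  ultimately show "(Delta d E Es \<circ> Psi d A E Es) (tau_op i m v) = (Psi d A E Es \<circ> Delta d E Es) (tau_op i m v)"
    by simp
qed

end

section \<open>The commutation theorem\<close>

text \<open>
  The idempotents add up to the identity because the sum fixes every eigenspace and these span the space.
\<close>
lemma (in td_space) spectral_family_of_idempotents:
  assumes A: "endo A" and diag: "diagonalizable A"
    and E: "bij_betw E {0..d} (primitive_idempotents A)"
    and rng: "bij_betw (\<lambda>i. range (E i)) {0..d} (eigenspaces A)"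
  obtains \<theta> where "spectral_family scale d A E \<theta>"
proof -
  have proj: "is_projection (range (E i)) (span (\<Union>(eigenspaces A - {range (E i)}))) (E i)" if "i \<le> d" for i
  proof -
    have "E i \<in> primitive_idempotents A" using E that by (auto simp: bij_betw_def)
    then obtain W where W: "is_projection W (span (\<Union>(eigenspaces A - {W}))) (E i)"
      by (auto simp: primitive_idempotents_def)
    then have "range (E i) = W" by (simp add: is_projection_def)
    then show ?thesis using W by simp
  qed
  have endoE: "endo (E i)" and idem: "E i (E i v) = E i v"
    and ker: "E i v = 0 \<longleftrightarrow> v \<in> span (\<Union>(eigenspaces A - {range (E i)}))" if "i \<le> d" for i v
    using proj[OF that] by (auto simp: is_projection_def dest: fun_cong[of _ _ v])
  have in_eig: "range (E i) \<in> eigenspaces A" if "i \<le> d" for i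
    using rng that by (auto simp: bij_betw_def)
  then have "\<forall>i. \<exists>c. i \<le> d \<longrightarrow> range (E i) = eigenspace A c \<and> eigenspace A c \<noteq> {0}"
    unfolding eigenspaces_def by blast
  then obtain \<theta> where \<theta>: "\<And>i. i \<le> d \<Longrightarrow> range (E i) = eigenspace A (\<theta> i) \<and> eigenspace A (\<theta> i) \<noteq> {0}"
    by metis
  have inj: "i = j" if "i \<le> d" "j \<le> d" "range (E i) = range (E j)" for i j
    using rng that by (auto simp: bij_betw_def inj_on_def)
  have orth: "E i (E j v) = 0" if "i \<le> d" "j \<le> d" "i \<noteq> j" for i j v
  proof -
    have "range (E j) \<in> eigenspaces A - {range (E i)}" using in_eig inj that by blast
    then have "E j v \<in> \<Union>(eigenspaces A - {range (E i)})" by (rule UnionI) (rule rangeI)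
    then have "E j v \<in> span (\<Union>(eigenspaces A - {range (E i)}))" by (rule span_base)
    then show ?thesis using ker[OF that(1)] by simp
  qed
  have sumE: "(\<Sum>i\<le>d. E i v) = v" for v
  proof -
    define f where "f v = (\<Sum>i\<le>d. E i v) - v" for v
    have f: "endo f"
      using endoE by (intro endoI) (simp_all add: f_def endo_add endo_scale sum.distrib scale_sum_right scale_right_diff_distrib)
    have "f x = 0" if x: "x \<in> \<Union>(eigenspaces A)" for x
    proof -
      obtain W where W: "W \<in> eigenspaces A" "x \<in> W" using x by (rule UnionE)
      then have "W \<in> (\<lambda>i. range (E i)) ` {0..d}" using bij_betw_imp_surj_on[OF rng] by simp
      then obtain j where j: "j \<le> d" "W = range (E j)" by (rule imageE) simp
      then have "x \<in> range (E j)" using W(2) by simp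
      then obtain w where w: "x = E j w" by (rule rangeE)
      have "(\<Sum>i\<le>d. E i x) = (\<Sum>i\<le>d. if i = j then E j w else 0)"
        unfolding w using j(1) orth idem by (intro sum.cong) auto
      then show ?thesis using j(1) w by (simp add: f_def)
    qed
    moreover have "subspace {v. f v = 0}"
      by (auto simp: subspace_def endo_0[OF f] endo_add[OF f] endo_scale[OF f])
    ultimately have "span (\<Union>(eigenspaces A)) \<subseteq> {v. f v = 0}" by (intro span_minimal) auto
    then have "f v = 0" using diag by (auto simp: diagonalizable_def)
    then show ?thesis by (simp add: f_def)
  qed
  have "spectral_family scale d A E \<theta>"
  proof (intro spectral_family.intro spectral_family_axioms.intro td_space_axioms)
    show "endo A" by fact
    show "endo (E i)" if "i \<le> d" for i using endoE[OF that] .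
    show "(\<Sum>i\<le>d. E i v) = v" for v by (rule sumE)
    show "E i (E j v) = (if i = j then E j v else 0)" if "i \<le> d" "j \<le> d" for i j v
      using that orth idem by auto
    show "A (E i v) = \<theta> i *s E i v" if "i \<le> d" for i v
    proof -
      have "E i v \<in> eigenspace A (\<theta> i)" using \<theta>[OF that] by blast
      then show ?thesis by (simp add: eigenspace_def)
    qed
    show "inj_on \<theta> {..d}" using inj \<theta> by (intro inj_onI) (metis atMost_iff)
    show "\<exists>v. E i v \<noteq> 0" if "i \<le> d" for i
    proof (rule ccontr)
      assume "\<not> ?thesis"
      then have "range (E i) = {0}" by auto
      then show False using \<theta>[OF that] by simp
    qed
  qed
  then show thesis by (rule that)
qed

lemma (in spectral_family) standard_ordering_orthogonal:
  assumes std: "standard_ordering A B d (\<lambda>i. range (E i))"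
    and ij: "i \<le> d" "j \<le> d" "Suc i < j \<or> Suc j < i"
  shows "E i (B (E j v)) = 0"
proof -
  have zero: "E i x = 0" if "x \<in> range (E h)" "h \<le> d" "h \<noteq> i" for x h
    using that ij(1) by (auto simp: E_E)
  have "B (E j v) \<in> (if j = 0 then {0} else range (E (j - 1))) + range (E j)
                        + (if j = d then {0} else range (E (j + 1)))"
    using std ij(2) unfolding standard_ordering_def by blast
  then obtain x y w where "B (E j v) = x + y + w" "x \<in> (if j = 0 then {0} else range (E (j - 1)))"
      "y \<in> range (E j)" "w \<in> (if j = d then {0} else range (E (j + 1)))"
    by (auto elim!: set_plus_elim)
  moreover from this have "E i x = 0" "E i y = 0" "E i w = 0"
    using zero[of x "j - 1"] zero[of y j] zero[of w "j + 1"] ij endo_0[OF endo_E[OF ij(1)]]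
    by (auto split: if_splits)
  ultimately show ?thesis by (simp add: endo_add[OF endo_E[OF ij(1)]])
qed

theorem theorem15p1:
  fixes scale :: "'a::field \<Rightarrow> 'b::ab_group_add \<Rightarrow> 'b"
    and Basis :: "'b set"
    and d :: nat
    and A As :: "'b \<Rightarrow> 'b"
    and E Es :: "nat \<Rightarrow> 'b \<Rightarrow> 'b"
  assumes "finite_dimensional_vector_space scale Basis"
    and "vector_space.dim scale (UNIV :: 'b set) > 0"
    and "td_space.tridiagonal_system scale d A E As Es"
    and "d \<ge> 1"
  shows "td_space.Delta scale d E Es \<circ> td_space.Psi scale d A E Es =
         td_space.Psi scale d A E Es \<circ> td_space.Delta scale d E Es"
proof -
  interpret fin: finite_dimensional_vector_space scale Basis by fact
  interpret td_space scale ..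
  have tds: "tridiagonal_pair A As" "bij_betw E {0..d} (primitive_idempotents A)"
      "standard_ordering A As d (\<lambda>i. range (E i))" "bij_betw Es {0..d} (primitive_idempotents As)"
      "standard_ordering As A d (\<lambda>i. range (Es i))"
    using assms(3) by (simp_all add: tridiagonal_system_def)
  have pair: "endo A" "endo As" "diagonalizable A" "diagonalizable As"
    using tds(1) by (simp_all add: tridiagonal_pair_def)
  obtain \<theta> where "spectral_family scale d A E \<theta>"
    using spectral_family_of_idempotents[OF pair(1,3) tds(2)] tds(3) by (auto simp: standard_ordering_def)
  then interpret s: spectral_family scale d A E \<theta> .
  obtain \<theta>s where "spectral_family scale d As Es \<theta>s"
    using spectral_family_of_idempotents[OF pair(2,4) tds(4)] tds(5) by (auto simp: standard_ordering_def)
  then interpret t: spectral_family scale d As Es \<theta>s .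
  interpret td_system scale Basis d A E \<theta> As Es \<theta>s
  proof unfold_locales
    show "E i (As (E j v)) = 0" if "i \<le> d" "j \<le> d" "Suc i < j \<or> Suc j < i" for i j v
      using s.standard_ordering_orthogonal[OF tds(3) that] .
    show "Es i (A (Es j v)) = 0" if "i \<le> d" "j \<le> d" "Suc i < j \<or> Suc j < i" for i j v
      using t.standard_ordering_orthogonal[OF tds(5) that] .
    show "W = {0} \<or> W = UNIV" if "fin.subspace W" "A ` W \<subseteq> W" "As ` W \<subseteq> W" for W
      using tds(1) that by (auto simp: tridiagonal_pair_def)
  qed
  show ?thesis by (rule Delta_Psi_commute)
qed

end
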